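(* Let $X$ be an Archimedean vector lattice and let $n\in\mathbb N$. Every uniformly closed sublattice of $X$ of codimension $n$ may be written as the intersection of $n$ uniformly closed sublattices of $X$ of codimension $1$.
   Context: Vector lattices are over $\mathbb R$. A sublattice is a linear subspace closed under $\vee$ and $\wedge$. For $e\in X_+$, $I_e$ is the principal ideal generated by $e$, with the norm $\|x\|_e=\inf\{\lambda>0 : |x|\le\lambda e\}$. A net $(x_\alpha)$ in $X$ converges (relatively) uniformly to $x\in X$ if there is $e\in X_+$ with $\|x_\alpha-x\|_e\to 0$ (in particular, $x_\alpha-x\in I_e$ for all sufficiently large $\alpha$). A subset $A\subseteq X$ is uniformly closed if it is closed with respect to uniform convergence; equivalently, $A\cap I_e$ is closed in $(I_e,\|\cdot\|_e)$ for every $e\in X_+$. A subspace $F$ of $X$ has codimension $n$ if $\dim X/F=n$. *)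

theory Defs
  imports "HOL-Analysis.Analysis" "HOL-Library.Lattice_Algebras"
begin

(* The parent class lattice_ab_group_add_abs provides the modulus |x| = sup x (- x). *)
class vector_lattice = ordered_real_vector + lattice_ab_group_add_abs

class archimedean_vector_lattice = vector_lattice +
  assumes archimedean: "0 \<le> x \<Longrightarrow> (\<And>n::nat. real n *\<^sub>R x \<le> y) \<Longrightarrow> x = 0"

instance real :: archimedean_vector_lattice
proof
  fix x y :: real
  assume x: "0 \<le> x" and le: "\<And>n::nat. real n *\<^sub>R x \<le> y"
  show "x = 0"
  proof (rule ccontr)
    assume "x \<noteq> 0"
    with x obtain n :: nat where "y < real n * x"
      using reals_Archimedean3[of x] by auto
    with le[of n] show False by simp
  qed
qed

definition sublattice :: "'a::vector_lattice set \<Rightarrow> bool" where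
  "sublattice F \<longleftrightarrow> subspace F \<and> (\<forall>x\<in>F. \<forall>y\<in>F. sup x y \<in> F \<and> inf x y \<in> F)"

definition principal_ideal :: "'a::vector_lattice \<Rightarrow> 'a set" where
  "principal_ideal e = {x. \<exists>r>0. \<bar>x\<bar> \<le> r *\<^sub>R e}"

(* Meaningful only for x in principal_ideal e: elsewhere it is the infimum of the empty set. *)
definition order_unit_norm :: "'a::vector_lattice \<Rightarrow> 'a \<Rightarrow> real" where
  "order_unit_norm e x = Inf {r. r > 0 \<and> \<bar>x\<bar> \<le> r *\<^sub>R e}"

(* Nets are rendered as in the library: a function together with a filter on its index type. *)
definition uniformly_converges :: "('i \<Rightarrow> 'a::vector_lattice) \<Rightarrow> 'a \<Rightarrow> 'i filter \<Rightarrow> bool" where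
  "uniformly_converges f x G \<longleftrightarrow>
     (\<exists>e\<ge>0. eventually (\<lambda>i. f i - x \<in> principal_ideal e) G \<and>
            ((\<lambda>i. order_unit_norm e (f i - x)) \<longlongrightarrow> 0) G)"

(* A definition cannot quantify over all index types. Filters on the space itself suffice,
   since a net may be replaced by its image filter; uniformly_closed_net and
   uniformly_closed_iff below confirm this. *)
definition uniformly_closed :: "'a::vector_lattice set \<Rightarrow> bool" where
  "uniformly_closed A \<longleftrightarrow>
     (\<forall>G x. G \<noteq> bot \<longrightarrow> eventually (\<lambda>y. y \<in> A) G \<longrightarrow>
            uniformly_converges (\<lambda>y. y) x G \<longrightarrow> x \<in> A)"

definition coset :: "'a::real_vector set \<Rightarrow> 'a \<Rightarrow> 'a set" where
  "coset F x = {x + f | f. f \<in> F}"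

(* dim X/F = n: the cosets of b 0, ..., b (n - 1) form a basis of the quotient space,
   in which a linear combination of cosets is the coset of the linear combination. *)
definition has_codimension :: "'a::real_vector set \<Rightarrow> nat \<Rightarrow> bool" where
  "has_codimension F n \<longleftrightarrow> subspace F \<and>
     (\<exists>b. (\<forall>c. coset F (\<Sum>i<n. c i *\<^sub>R b i) = coset F 0 \<longrightarrow> (\<forall>i<n. c i = 0)) \<and>
          (\<forall>x. \<exists>c. coset F x = coset F (\<Sum>i<n. c i *\<^sub>R b i)))"

lemma coset_eq_iff:
  assumes F: "subspace F"
  shows "coset F x = coset F y \<longleftrightarrow> x - y \<in> F"
proof
  assume "coset F x = coset F y"
  moreover have "x \<in> coset F x"
    using subspace_0[OF F] by (force simp: coset_def)
  ultimately obtain f where "x = y + f" "f \<in> F" by (auto simp: coset_def)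
  thus "x - y \<in> F" by simp
next
  assume d: "x - y \<in> F"
  have *: "coset F u \<subseteq> coset F v" if "u - v \<in> F" for u v
  proof
    fix z assume "z \<in> coset F u"
    then obtain f where f: "z = u + f" "f \<in> F" by (auto simp: coset_def)
    have "z = v + ((u - v) + f)" "(u - v) + f \<in> F"
      using f that subspace_add[OF F] by auto
    thus "z \<in> coset F v" unfolding coset_def by blast
  qed
  have "y - x \<in> F" using subspace_neg[OF F d] by simp
  with d * show "coset F x = coset F y" by blast
qed

lemma has_codimension_le:
  fixes F :: "'a::real_vector set"
  assumes "has_codimension F n" "has_codimension F m"
  shows "n \<le> m"
proof -
  have F: "subspace F" using assms by (simp add: has_codimension_def)
  obtain b where b: "\<And>c. (\<Sum>i<n. c i *\<^sub>R b i) \<in> F \<Longrightarrow> \<forall>i<n. c i = 0"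
  proof -
    obtain b where "\<forall>c. (\<Sum>i<n. c i *\<^sub>R b i) \<in> F \<longrightarrow> (\<forall>i<n. c i = 0)"
      using assms(1) by (auto simp: has_codimension_def coset_eq_iff)
    with that show thesis by blast
  qed
  obtain d where d: "\<And>x. \<exists>c. x - (\<Sum>i<m. c i *\<^sub>R d i) \<in> F"
  proof -
    obtain d where "\<forall>x. \<exists>c. x - (\<Sum>i<m. c i *\<^sub>R d i) \<in> F"
      using assms(2) by (auto simp: has_codimension_def coset_eq_iff)
    with that show thesis by blast
  qed
  obtain C where C: "\<And>x. x - (\<Sum>j<m. C x j *\<^sub>R d j) \<in> F"
    using d by metis
  define v where "v i = (\<Sum>j<m. C (b i) j *\<^sub>R d j)" for i
  have v0: "\<forall>i<n. c i = 0" if "(\<Sum>i<n. c i *\<^sub>R v i) = 0" for c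
  proof (rule b)
    have "(\<Sum>i<n. c i *\<^sub>R b i) = (\<Sum>i<n. c i *\<^sub>R (b i - v i))"
      using that by (simp add: scaleR_diff_right sum_subtractf)
    also have "\<dots> \<in> F"
      using C by (intro subspace_sum[OF F] subspace_scale[OF F]) (simp add: v_def)
    finally show "(\<Sum>i<n. c i *\<^sub>R b i) \<in> F" .
  qed
  have inj: "inj_on v {..<n}"
  proof (rule inj_onI, rule ccontr)
    fix i k assume ik: "i \<in> {..<n}" "k \<in> {..<n}" "v i = v k" "i \<noteq> k"
    define c where "c l = (if l = i then 1 else if l = k then -1 else (0::real))" for l
    have "(\<Sum>l<n. c l *\<^sub>R v l) = (\<Sum>l\<in>{i,k}. c l *\<^sub>R v l)"
      using ik by (intro sum.mono_neutral_right) (auto simp: c_def)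
    also have "\<dots> = 0" using ik by (simp add: c_def)
    finally have "c i = 0" using v0[of c] ik by auto
    thus False by (simp add: c_def)
  qed
  have "independent (v ` {..<n})"
  proof (rule independent_if_scalars_zero)
    fix g x assume s: "(\<Sum>x\<in>v ` {..<n}. g x *\<^sub>R x) = 0" and x: "x \<in> v ` {..<n}"
    have "(\<Sum>i<n. g (v i) *\<^sub>R v i) = 0"
      using s by (simp add: sum.reindex[OF inj])
    from v0[OF this] x show "g x = 0" by auto
  qed simp
  moreover have "v ` {..<n} \<subseteq> span (d ` {..<m})"
    by (auto simp: v_def intro!: span_sum span_scale intro: span_base)
  ultimately have "card (v ` {..<n}) \<le> card (d ` {..<m})"
    using independent_span_bound by blast
  also have "\<dots> \<le> m" using card_image_le[of "{..<m}" d] by simp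
  finally show ?thesis using inj by (simp add: card_image)
qed

lemma has_codimension_unique:
  "has_codimension F n \<Longrightarrow> has_codimension F m \<Longrightarrow> n = m"
  by (simp add: has_codimension_le order_antisym)

lemma uniformly_closed_net:
  assumes A: "uniformly_closed A" and G: "G \<noteq> bot"
    and ev: "eventually (\<lambda>i. f i \<in> A) G" and conv: "uniformly_converges f x G"
  shows "x \<in> A"
proof -
  have "filtermap f G \<noteq> bot" using G by (simp add: filtermap_bot_iff)
  moreover have "eventually (\<lambda>y. y \<in> A) (filtermap f G)"
    using ev by (simp add: eventually_filtermap)
  moreover have "uniformly_converges (\<lambda>y. y) x (filtermap f G)"
    using conv by (simp add: uniformly_converges_def eventually_filtermap filterlim_filtermap)
  ultimately show ?thesis using A unfolding uniformly_closed_def by blast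
qed

lemma order_unit_norm_nonneg:
  "x \<in> principal_ideal e \<Longrightarrow> 0 \<le> order_unit_norm e x"
  unfolding order_unit_norm_def principal_ideal_def by (rule cInf_greatest) auto

lemma principal_ideal_add:
  assumes "x \<in> principal_ideal e" "y \<in> principal_ideal e"
  shows "x + y \<in> principal_ideal e"
proof -
  obtain s t where st: "s > 0" "\<bar>x\<bar> \<le> s *\<^sub>R e" "t > 0" "\<bar>y\<bar> \<le> t *\<^sub>R e"
    using assms by (auto simp: principal_ideal_def)
  have "\<bar>x + y\<bar> \<le> \<bar>x\<bar> + \<bar>y\<bar>" by (rule abs_triangle_ineq)
  also have "\<dots> \<le> (s + t) *\<^sub>R e"
    using st by (simp add: scaleR_left_distrib add_mono)
  finally show ?thesis using st by (auto simp: principal_ideal_def intro!: exI[of _ "s + t"])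
qed

lemma principal_ideal_minus:
  "x \<in> principal_ideal e \<Longrightarrow> - x \<in> principal_ideal e"
  by (simp add: principal_ideal_def)

lemma principal_ideal_mono:
  assumes "0 \<le> e" "e \<le> e'"
  shows "principal_ideal e \<subseteq> principal_ideal e'"
proof
  fix x assume "x \<in> principal_ideal e"
  then obtain s where s: "s > 0" "\<bar>x\<bar> \<le> s *\<^sub>R e" by (auto simp: principal_ideal_def)
  have "s *\<^sub>R e \<le> s *\<^sub>R e'" using s assms by (simp add: scaleR_left_mono)
  with s show "x \<in> principal_ideal e'" unfolding principal_ideal_def by (auto intro: order_trans)
qed

lemma order_unit_norm_antimono:
  assumes "0 \<le> e" "e \<le> e'" "x \<in> principal_ideal e"
  shows "order_unit_norm e' x \<le> order_unit_norm e x"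
  unfolding order_unit_norm_def
proof (rule cInf_superset_mono)
  show "{r. r > 0 \<and> \<bar>x\<bar> \<le> r *\<^sub>R e} \<noteq> {}"
    using assms(3) by (auto simp: principal_ideal_def)
  show "bdd_below {r. r > 0 \<and> \<bar>x\<bar> \<le> r *\<^sub>R e'}"
    by (rule bdd_belowI[of _ 0]) auto
  show "{r. r > 0 \<and> \<bar>x\<bar> \<le> r *\<^sub>R e} \<subseteq> {r. r > 0 \<and> \<bar>x\<bar> \<le> r *\<^sub>R e'}"
    using assms(2) by (auto intro: order_trans[OF _ scaleR_left_mono])
qed

(* Uniform closedness: the intersection of A with each I_e is closed in (I_e, ||.||_e). *)
lemma uniformly_closed_iff:
  "uniformly_closed A \<longleftrightarrow>
     (\<forall>e\<ge>0. \<forall>x\<in>principal_ideal e.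
        (\<forall>\<epsilon>>0. \<exists>y\<in>A \<inter> principal_ideal e. order_unit_norm e (y - x) < \<epsilon>) \<longrightarrow> x \<in> A)"
  (is "_ \<longleftrightarrow> ?R")
proof
  assume A: "uniformly_closed A"
  show ?R
  proof (intro allI impI ballI)
    fix e x :: 'a
    assume e: "0 \<le> e" and x: "x \<in> principal_ideal e"
      and *: "\<forall>\<epsilon>>0. \<exists>y\<in>A \<inter> principal_ideal e. order_unit_norm e (y - x) < \<epsilon>"
    have "\<exists>y\<in>A \<inter> principal_ideal e. order_unit_norm e (y - x) < inverse (real (Suc k))" for k
      using * by simp
    then obtain f where f: "\<And>k. f k \<in> A" "\<And>k. f k \<in> principal_ideal e"
        "\<And>k. order_unit_norm e (f k - x) < inverse (real (Suc k))" by (metis IntE)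
    have mem: "f k - x \<in> principal_ideal e" for k
      using principal_ideal_add[OF f(2) principal_ideal_minus[OF x]] by simp
    have "(\<lambda>k. order_unit_norm e (f k - x)) \<longlonglongrightarrow> 0"
    proof (rule tendsto_sandwich[OF _ _ tendsto_const LIMSEQ_inverse_real_of_nat])
      show "eventually (\<lambda>k. 0 \<le> order_unit_norm e (f k - x)) sequentially"
        using mem by (simp add: order_unit_norm_nonneg)
      show "eventually (\<lambda>k. order_unit_norm e (f k - x) \<le> inverse (real (Suc k))) sequentially"
        using f(3) by (intro always_eventually allI less_imp_le)
    qed
    hence "uniformly_converges f x sequentially"
      unfolding uniformly_converges_def using e mem by auto
    thus "x \<in> A"
      by (rule uniformly_closed_net[OF A sequentially_bot, rotated]) (use f in auto)
  qed
next
  assume R: ?R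
  show "uniformly_closed A"
    unfolding uniformly_closed_def
  proof (intro allI impI)
    fix G x assume G: "G \<noteq> bot" and ev: "eventually (\<lambda>y. y \<in> A) G"
      and "uniformly_converges (\<lambda>y. y) x G"
    then obtain e where e: "0 \<le> e" "eventually (\<lambda>y. y - x \<in> principal_ideal e) G"
        "((\<lambda>y. order_unit_norm e (y - x)) \<longlongrightarrow> 0) G"
      unfolding uniformly_converges_def by auto
    define e' where "e' = e + \<bar>x\<bar>"
    have e': "e \<le> e'" "0 \<le> e'" "\<bar>x\<bar> \<le> e'" using e by (simp_all add: e'_def)
    have x: "x \<in> principal_ideal e'"
      unfolding principal_ideal_def using e' by (auto intro!: exI[of _ 1])
    have "\<exists>y\<in>A \<inter> principal_ideal e'. order_unit_norm e' (y - x) < \<epsilon>" if "\<epsilon> > 0" for \<epsilon>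
    proof -
      have "eventually (\<lambda>y. order_unit_norm e (y - x) < \<epsilon>) G"
        using order_tendstoD(2)[OF e(3) that] .
      with ev e(2) have "eventually (\<lambda>y. y \<in> A \<and> y - x \<in> principal_ideal e \<and>
          order_unit_norm e (y - x) < \<epsilon>) G" by (simp add: eventually_conj_iff)
      then obtain y where y: "y \<in> A" "y - x \<in> principal_ideal e"
          "order_unit_norm e (y - x) < \<epsilon>"
        using eventually_happens'[OF G] by blast
      have "y - x \<in> principal_ideal e'" using y principal_ideal_mono[OF e(1) e'(1)] by auto
      from principal_ideal_add[OF this x] have "y \<in> principal_ideal e'" by simp
      thus ?thesis using y order_unit_norm_antimono[OF e(1) e'(1) y(2)] by force
    qed
    with R e' x show "x \<in> A" by blast
  qed
qed

end

theory Submission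
  imports Defs
begin

text \<open>
Let \<open>J\<close> be the largest order ideal contained in \<open>F\<close>. It is uniformly closed because \<open>F\<close> is.
The main step is that \<open>J\<close> is an intersection of kernels of finitely many lattice homomorphisms
into the reals, so that \<open>F\<close> contains such an intersection.

First, pairwise disjoint positive elements outside \<open>J\<close> are fewer than \<open>(n + 1)\<^sup>2\<close>
(\<open>disjoint_family_off_ideal_core_bound\<close>). Below each of them lies a positive element outside
\<open>F\<close>. By finite codimension, any \<open>n + 1\<close> of these have a nontrivial combination in \<open>F\<close>, and
positive parts and infima of such combinations eventually isolate a single element, which would
then be in \<open>F\<close>.

Take a disjoint family \<open>x 0, \<dots>, x (m - 1)\<close> outside \<open>J\<close> of maximal length. By maximality, the
ideals \<open>{y. inf \<bar>y\<bar> (x i) \<in> J}\<close> are prime and their intersection is contained in \<open>J\<close>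
(\<open>maximal_disjoint_family_lattice_homs\<close>); they are also uniformly closed, and a proper uniformly
closed prime ideal is the kernel of a lattice homomorphism (\<open>prime_ideal_lattice_hom\<close>).

So \<open>F\<close> is determined by its image in a finite-dimensional coordinate space. By the lattice
argument of Stone and Weierstrass (\<open>two_point_interpolation\<close>), a point \<open>z\<close> outside \<open>F\<close> is
already separated from \<open>F\<close> by two of the homomorphisms, and a proper sublattice of the plane
satisfies a linear relation whose coefficients have opposite signs or of which one is zero. This
yields a functional of the form \<open>p k - q h\<close> with \<open>p, q \<ge> 0\<close> that vanishes on \<open>F\<close> but not at
\<open>z\<close> (\<open>codimension_one_separation\<close>). The kernel of such a functional is a uniformly closed
sublattice of codimension one. Since these functionals separate the points outside \<open>F\<close> from
\<open>F\<close>, linear algebra selects \<open>n\<close> of them whose kernels intersect in \<open>F\<close>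
(\<open>finitely_many_functionals_suffice\<close>).
\<close>

section \<open>Computation in vector lattices\<close>

\<comment> \<open>These rules would rewrite differences that involve infima and suprema.\<close>
declare neg_inf_eq_sup [simp del] neg_sup_eq_inf [simp del]
  diff_inf_eq_sup [simp del] diff_sup_eq_inf [simp del]

lemma scaleR_sup_nonneg:
  fixes x y :: "'a::vector_lattice"
  assumes "0 \<le> c"
  shows "c *\<^sub>R sup x y = sup (c *\<^sub>R x) (c *\<^sub>R y)"
proof (cases "c = 0")
  case False
  with assms have c: "0 < c" by simp
  have le: "sup (a *\<^sub>R u) (a *\<^sub>R v) \<le> a *\<^sub>R sup u v" if "0 < a" for a and u v :: 'a
    using that by (simp add: scaleR_left_mono)
  have "sup (inverse c *\<^sub>R c *\<^sub>R x) (inverse c *\<^sub>R c *\<^sub>R y)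
      \<le> inverse c *\<^sub>R sup (c *\<^sub>R x) (c *\<^sub>R y)"
    using c by (intro le) simp
  hence "c *\<^sub>R sup x y \<le> c *\<^sub>R inverse c *\<^sub>R sup (c *\<^sub>R x) (c *\<^sub>R y)"
    using c by (intro scaleR_left_mono) simp_all
  thus ?thesis using c le[OF c, of x y] by (intro antisym) simp_all
qed simp

lemma abs_scaleR_lattice:
  fixes x :: "'a::vector_lattice"
  shows "\<bar>c *\<^sub>R x\<bar> = \<bar>c\<bar> *\<^sub>R \<bar>x\<bar>"
proof (cases "0 \<le> c")
  case True
  thus ?thesis by (simp add: abs_lattice[of x] abs_lattice[of "c *\<^sub>R x"] scaleR_sup_nonneg)
next
  case False
  hence "\<bar>- c\<bar> *\<^sub>R \<bar>x\<bar> = sup (- c *\<^sub>R x) (- c *\<^sub>R (- x))"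
    unfolding abs_lattice[of x] by (subst scaleR_sup_nonneg[symmetric]) auto
  thus ?thesis by (simp add: abs_lattice[of "c *\<^sub>R x"] sup_commute)
qed

lemma double_pprt: "2 *\<^sub>R pprt x = x + \<bar>x\<bar>" for x :: "'a::vector_lattice"
proof -
  have "x + \<bar>x\<bar> = (pprt x + nprt x) + (pprt x - nprt x)"
    using prts[of x] abs_prts[of x] by simp
  thus ?thesis by (simp add: scaleR_2)
qed

lemma pprt_eq_half: "pprt x = (1/2) *\<^sub>R (x + \<bar>x\<bar>)" for x :: "'a::vector_lattice"
  by (simp flip: double_pprt)

lemma sup_eq_add_pprt: "sup x y = y + pprt (x - y)" for x y :: "'a::lattice_ab_group_add"
  by (simp add: pprt_def add_sup_distrib_left)

lemma inf_eq_diff_pprt: "inf x y = x - pprt (x - y)" for x y :: "'a::lattice_ab_group_add"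
  by (simp add: pprt_def diff_sup_eq_inf add_inf_distrib_left inf_commute)

lemma scaleR_inf_nonneg:
  fixes x y :: "'a::vector_lattice"
  assumes "0 \<le> c"
  shows "c *\<^sub>R inf x y = inf (c *\<^sub>R x) (c *\<^sub>R y)"
  using assms by (simp add: inf_eq_diff_pprt pprt_def scaleR_diff_right scaleR_sup_nonneg)

lemma eq_pprt_diff: "x = pprt x - pprt (- x)" for x :: "'a::lattice_ab_group_add"
  using prts[of x] by (simp add: pprt_neg)

lemma pprt_le_abs: "pprt x \<le> \<bar>x\<bar>" for x :: "'a::lattice_ab_group_add_abs"
  by (simp add: pprt_def abs_ge_self)

lemma inf_pprt_pprt_minus: "inf (pprt x) (pprt (- x)) = 0"
  for x :: "'a::lattice_ab_group_add"
proof -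
  have "inf (pprt x) (pprt (- x)) = pprt x - pprt (pprt x - pprt (- x))"
    by (rule inf_eq_diff_pprt)
  thus ?thesis by (simp flip: eq_pprt_diff)
qed

lemma inf_pprt_diff_diff: "inf (pprt (x - y)) (pprt (y - x)) = 0"
  for x y :: "'a::lattice_ab_group_add"
  using inf_pprt_pprt_minus[of "x - y"] by simp

lemma inf_add_le:
  fixes x y z :: "'a::lattice_ab_group_add"
  assumes "0 \<le> x" "0 \<le> y" "0 \<le> z"
  shows "inf (x + y) z \<le> inf x z + inf y z"
proof -
  have "inf (x + y) z \<le> y + x" "inf (x + y) z \<le> y + z" "inf (x + y) z \<le> z + x"
      "inf (x + y) z \<le> z + z"
    using assms by (auto simp: add.commute intro: le_infI2 add_increasing add_increasing2)
  thus ?thesis by (simp add: add_inf_distrib_left add_inf_distrib_right add.commute)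
qed

lemma inf_sum_le:
  fixes x :: "'i \<Rightarrow> 'a::lattice_ab_group_add"
  assumes "finite I" "\<And>i. i \<in> I \<Longrightarrow> 0 \<le> x i" "0 \<le> z"
  shows "inf (sum x I) z \<le> (\<Sum>i\<in>I. inf (x i) z)"
  using assms
proof (induction I rule: finite_induct)
  case (insert i I)
  have "inf (x i + sum x I) z \<le> inf (x i) z + inf (sum x I) z"
    using insert by (intro inf_add_le sum_nonneg) auto
  also have "\<dots> \<le> inf (x i) z + (\<Sum>i\<in>I. inf (x i) z)" using insert by simp
  finally show ?case using insert by simp
qed simp

lemma disjoint_mono:
  fixes x y :: "'a::lattice_ab_group_add"
  assumes "inf x y = 0" "0 \<le> u" "u \<le> x" "0 \<le> v" "v \<le> y"
  shows "inf u v = 0"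
  using inf_mono[OF assms(3,5)] assms by (intro antisym) simp_all

lemma disjoint_scaleR:
  fixes x y :: "'a::vector_lattice"
  assumes "inf x y = 0" "0 \<le> a" "0 \<le> b"
  shows "inf (a *\<^sub>R x) (b *\<^sub>R y) = 0"
proof -
  define c where "c = a + b"
  have xy: "0 \<le> x" "0 \<le> y" using assms(1) by (metis inf_le1, metis inf_le2)
  have "inf (c *\<^sub>R x) (c *\<^sub>R y) = 0"
    using assms by (simp add: c_def flip: scaleR_inf_nonneg)
  thus ?thesis
    by (rule disjoint_mono) (use assms xy in \<open>
      auto simp: c_def scaleR_right_mono scaleR_nonneg_nonneg\<close>)
qed

lemma disjoint_sum:
  fixes x :: "'i \<Rightarrow> 'a::lattice_ab_group_add"
  assumes "finite I" "\<And>i. i \<in> I \<Longrightarrow> 0 \<le> x i" "0 \<le> z" "\<And>i. i \<in> I \<Longrightarrow> inf (x i) z = 0"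
  shows "inf (sum x I) z = 0"
  using inf_sum_le[OF assms(1-3)] assms by (intro antisym) (simp_all add: sum_nonneg)

lemma disjoint_sum_sum:
  fixes x :: "'i \<Rightarrow> 'a::lattice_ab_group_add"
  assumes "finite I" "finite K" "\<And>i. i \<in> I \<Longrightarrow> 0 \<le> x i" "\<And>k. k \<in> K \<Longrightarrow> 0 \<le> y k"
    "\<And>i k. i \<in> I \<Longrightarrow> k \<in> K \<Longrightarrow> inf (x i) (y k) = 0"
  shows "inf (sum x I) (sum y K) = 0"
proof (rule disjoint_sum)
  fix i assume "i \<in> I"
  hence "inf (sum y K) (x i) = 0"
    using assms by (intro disjoint_sum) (auto simp: inf_commute)
  thus "inf (x i) (sum y K) = 0" by (simp add: inf_commute)
qed (use assms in \<open>auto intro: sum_nonneg\<close>)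

section \<open>Uniformly closed sets, sublattices and ideals\<close>

text \<open>The working form of uniform closedness: the order unit norm is replaced by the inequalities
\<open>\<bar>y - x\<bar> \<le> \<epsilon> *\<^sub>R e\<close>, and \<open>x\<close> need not lie in the principal ideal of \<open>e\<close>,
since the regulator can be enlarged by \<open>\<bar>x\<bar>\<close>.\<close>

lemma uniformly_closed_iff_approx:
  fixes A :: "'a::vector_lattice set"
  shows "uniformly_closed A \<longleftrightarrow>
    (\<forall>e\<ge>0. \<forall>x. (\<forall>\<epsilon>>0. \<exists>y\<in>A. \<bar>y - x\<bar> \<le> \<epsilon> *\<^sub>R e) \<longrightarrow> x \<in> A)"
  (is "_ \<longleftrightarrow> ?R")
proof
  assume A: "uniformly_closed A"
  show ?R
  proof (intro allI impI)
    fix e x :: 'a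
    assume e: "0 \<le> e" and *: "\<forall>\<epsilon>>0. \<exists>y\<in>A. \<bar>y - x\<bar> \<le> \<epsilon> *\<^sub>R e"
    define e' where "e' = e + \<bar>x\<bar>"
    have e': "0 \<le> e'" "e \<le> e'" "\<bar>x\<bar> \<le> e'" using e by (simp_all add: e'_def)
    have x: "x \<in> principal_ideal e'"
      unfolding principal_ideal_def using e' by (auto intro!: exI[of _ 1])
    have "\<exists>y\<in>A \<inter> principal_ideal e'. order_unit_norm e' (y - x) < \<epsilon>" if "\<epsilon> > 0" for \<epsilon>
    proof -
      obtain y where y: "y \<in> A" "\<bar>y - x\<bar> \<le> (\<epsilon> / 2) *\<^sub>R e"
        using * \<open>\<epsilon> > 0\<close> by (metis half_gt_zero)
      have le: "\<bar>y - x\<bar> \<le> (\<epsilon> / 2) *\<^sub>R e'"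
        using y(2) scaleR_left_mono[OF e'(2), of "\<epsilon> / 2"] \<open>\<epsilon> > 0\<close> by (auto intro: order_trans)
      hence "y - x \<in> principal_ideal e'"
        unfolding principal_ideal_def using \<open>\<epsilon> > 0\<close> by (auto intro!: exI[of _ "\<epsilon> / 2"])
      from principal_ideal_add[OF this x] have mem: "y \<in> principal_ideal e'" by simp
      have "order_unit_norm e' (y - x) \<le> \<epsilon> / 2"
        unfolding order_unit_norm_def
        by (rule cInf_lower) (use le \<open>\<epsilon> > 0\<close> in \<open>auto intro!: bdd_belowI[of _ 0]\<close>)
      with y(1) mem \<open>\<epsilon> > 0\<close> show ?thesis by (intro bexI[of _ y]) auto
    qed
    with A e' x show "x \<in> A" unfolding uniformly_closed_iff by blast
  qed
next
  assume R: ?R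
  show "uniformly_closed A"
    unfolding uniformly_closed_iff
  proof (intro allI impI ballI)
    fix e x :: 'a
    assume e: "0 \<le> e" and x: "x \<in> principal_ideal e"
      and *: "\<forall>\<epsilon>>0. \<exists>y\<in>A \<inter> principal_ideal e. order_unit_norm e (y - x) < \<epsilon>"
    have "\<exists>y\<in>A. \<bar>y - x\<bar> \<le> \<epsilon> *\<^sub>R e" if "\<epsilon> > 0" for \<epsilon>
    proof -
      obtain y where y: "y \<in> A" "y \<in> principal_ideal e" "order_unit_norm e (y - x) < \<epsilon>"
        using * \<open>\<epsilon> > 0\<close> by blast
      have "y - x \<in> principal_ideal e"
        using principal_ideal_add[OF y(2) principal_ideal_minus[OF x]] by simp
      hence "{r. r > 0 \<and> \<bar>y - x\<bar> \<le> r *\<^sub>R e} \<noteq> {}" by (auto simp: principal_ideal_def)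
      from cInf_lessD[OF this y(3)[unfolded order_unit_norm_def]]
      obtain r where "\<bar>y - x\<bar> \<le> r *\<^sub>R e" "r < \<epsilon>" by auto
      hence "\<bar>y - x\<bar> \<le> \<epsilon> *\<^sub>R e"
        using e by (meson less_imp_le order_trans scaleR_right_mono)
      with y(1) show ?thesis by blast
    qed
    with R e show "x \<in> A" by blast
  qed
qed

lemma uniformly_closedD:
  assumes "uniformly_closed A" "0 \<le> e" "\<And>\<epsilon>. \<epsilon> > 0 \<Longrightarrow> \<exists>y\<in>A. \<bar>y - x\<bar> \<le> \<epsilon> *\<^sub>R e"
  shows "x \<in> A"
  using assms unfolding uniformly_closed_iff_approx by blast

lemma sublattice_iff_abs:
  "sublattice F \<longleftrightarrow> subspace F \<and> (\<forall>x\<in>F. \<bar>x\<bar> \<in> F)"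
proof
  assume F: "sublattice F"
  thus "subspace F \<and> (\<forall>x\<in>F. \<bar>x\<bar> \<in> F)"
    by (auto simp: sublattice_def abs_lattice subspace_neg)
next
  assume F: "subspace F \<and> (\<forall>x\<in>F. \<bar>x\<bar> \<in> F)"
  have pp: "pprt x \<in> F" if "x \<in> F" for x
    unfolding pprt_eq_half using F that by (blast intro: subspace_scale subspace_add)
  show "sublattice F"
    unfolding sublattice_def sup_eq_add_pprt inf_eq_diff_pprt
    using F pp by (blast intro: subspace_add subspace_diff)
qed

lemma sublattice_pprt: "sublattice F \<Longrightarrow> x \<in> F \<Longrightarrow> pprt x \<in> F"
  unfolding pprt_def by (simp add: sublattice_def subspace_0)

text \<open>Order ideals in the sense of vector lattices: solid linear subspaces.\<close>

definition order_ideal :: "'a::vector_lattice set \<Rightarrow> bool" where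
  "order_ideal J \<longleftrightarrow> subspace J \<and> (\<forall>x\<in>J. \<forall>y. \<bar>y\<bar> \<le> \<bar>x\<bar> \<longrightarrow> y \<in> J)"

lemma order_ideal_subspace: "order_ideal J \<Longrightarrow> subspace J"
  by (simp add: order_ideal_def)

lemma order_idealD: "order_ideal J \<Longrightarrow> x \<in> J \<Longrightarrow> \<bar>y\<bar> \<le> \<bar>x\<bar> \<Longrightarrow> y \<in> J"
  by (auto simp: order_ideal_def)

lemma order_ideal_le: "order_ideal J \<Longrightarrow> x \<in> J \<Longrightarrow> 0 \<le> y \<Longrightarrow> y \<le> x \<Longrightarrow> y \<in> J"
  by (rule order_idealD[of J x]) (auto intro: order_trans[OF _ abs_ge_self])

lemma order_ideal_abs_iff: "order_ideal J \<Longrightarrow> \<bar>x\<bar> \<in> J \<longleftrightarrow> x \<in> J"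
  by (auto intro: order_idealD)

text \<open>How uniform closedness of an ideal is used: it suffices that the part of \<open>u\<close> exceeding
\<open>\<epsilon> *\<^sub>R e\<close> lies in the ideal, because this part differs from \<open>u\<close> by
\<open>inf u (\<epsilon> *\<^sub>R e)\<close>.\<close>

lemma order_ideal_approx:
  assumes J: "order_ideal J" "uniformly_closed J" and e: "0 \<le> e" and u: "0 \<le> u"
    and approx: "\<And>\<epsilon>. \<epsilon> > 0 \<Longrightarrow> pprt (u - \<epsilon> *\<^sub>R e) \<in> J"
  shows "u \<in> J"
proof (rule uniformly_closedD[OF J(2) e])
  fix \<epsilon> :: real assume "\<epsilon> > 0"
  have "pprt (u - \<epsilon> *\<^sub>R e) - u = - inf u (\<epsilon> *\<^sub>R e)" by (simp add: inf_eq_diff_pprt)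
  hence "\<bar>pprt (u - \<epsilon> *\<^sub>R e) - u\<bar> = inf u (\<epsilon> *\<^sub>R e)"
    using u e \<open>\<epsilon> > 0\<close> by (simp add: scaleR_nonneg_nonneg)
  thus "\<exists>y\<in>J. \<bar>y - u\<bar> \<le> \<epsilon> *\<^sub>R e"
    using approx[OF \<open>\<epsilon> > 0\<close>] by (intro bexI[of _ "pprt (u - \<epsilon> *\<^sub>R e)"]) auto
qed

text \<open>The largest order ideal contained in \<open>F\<close>, when \<open>F\<close> is a sublattice.\<close>

definition ideal_core :: "'a::vector_lattice set \<Rightarrow> 'a set" where
  "ideal_core F = {x. \<forall>y. \<bar>y\<bar> \<le> \<bar>x\<bar> \<longrightarrow> y \<in> F}"

lemma ideal_core_subset: "ideal_core F \<subseteq> F"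
  by (auto simp: ideal_core_def)

lemma mem_ideal_core_iff:
  assumes "subspace F"
  shows "x \<in> ideal_core F \<longleftrightarrow> (\<forall>y. 0 \<le> y \<longrightarrow> y \<le> \<bar>x\<bar> \<longrightarrow> y \<in> F)"
proof
  assume R: "\<forall>y. 0 \<le> y \<longrightarrow> y \<le> \<bar>x\<bar> \<longrightarrow> y \<in> F"
  have "y \<in> F" if "\<bar>y\<bar> \<le> \<bar>x\<bar>" for y
  proof -
    have "pprt y \<le> \<bar>x\<bar>" "pprt (- y) \<le> \<bar>x\<bar>"
      using that pprt_le_abs[of y] pprt_le_abs[of "- y"] by (auto intro: order_trans)
    hence "pprt y - pprt (- y) \<in> F"
      using R assms by (intro subspace_diff) auto
    thus ?thesis by (simp flip: eq_pprt_diff)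
  qed
  thus "x \<in> ideal_core F" by (simp add: ideal_core_def)
qed (auto simp: ideal_core_def)

lemma order_ideal_ideal_core:
  assumes F: "sublattice F"
  shows "order_ideal (ideal_core F)"
proof -
  have sub: "subspace F" using F by (simp add: sublattice_def)
  note core = mem_ideal_core_iff[OF sub]
  have "subspace (ideal_core F)"
  proof (rule subspaceI)
    show "0 \<in> ideal_core F" using subspace_0[OF sub] by (simp add: ideal_core_def)
  next
    fix x y assume x: "x \<in> ideal_core F" and y: "y \<in> ideal_core F"
    have "z \<in> F" if z: "0 \<le> z" "z \<le> \<bar>x + y\<bar>" for z
    proof -
      have "z \<le> \<bar>x\<bar> + \<bar>y\<bar>" using z abs_triangle_ineq[of x y] by simp
      hence "pprt (z - \<bar>x\<bar>) \<le> \<bar>y\<bar>" by (simp add: pprt_def algebra_simps)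
      hence "pprt (z - \<bar>x\<bar>) \<in> F" using y core by simp
      moreover have "inf z \<bar>x\<bar> \<in> F" using x z core by simp
      ultimately have "inf z \<bar>x\<bar> + pprt (z - \<bar>x\<bar>) \<in> F" using sub by (simp add: subspace_add)
      thus ?thesis by (simp add: inf_eq_diff_pprt)
    qed
    thus "x + y \<in> ideal_core F" by (simp add: core)
  next
    fix c :: real and x assume x: "x \<in> ideal_core F"
    have "z \<in> F" if z: "\<bar>z\<bar> \<le> \<bar>c *\<^sub>R x\<bar>" for z
    proof (cases "c = 0")
      case True
      thus ?thesis using z subspace_0[OF sub] by simp
    next
      case False
      hence "\<bar>inverse c *\<^sub>R z\<bar> \<le> \<bar>x\<bar>"
        using z scaleR_left_mono[of "\<bar>z\<bar>" "\<bar>c\<bar> *\<^sub>R \<bar>x\<bar>" "inverse \<bar>c\<bar>"]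
        by (simp add: abs_scaleR_lattice)
      hence "c *\<^sub>R inverse c *\<^sub>R z \<in> F"
        using x by (intro subspace_scale[OF sub, of "inverse c *\<^sub>R z" c])
          (simp only: ideal_core_def mem_Collect_eq)
      thus ?thesis using False by simp
    qed
    thus "c *\<^sub>R x \<in> ideal_core F" by (simp add: ideal_core_def)
  qed
  thus ?thesis by (auto simp: order_ideal_def ideal_core_def intro: order_trans)
qed

lemma uniformly_closed_ideal_core:
  assumes F: "sublattice F" "uniformly_closed F"
  shows "uniformly_closed (ideal_core F)"
  unfolding uniformly_closed_iff_approx
proof (intro allI impI)
  fix e x :: 'a
  assume e: "0 \<le> e" and approx: "\<forall>\<epsilon>>0. \<exists>y\<in>ideal_core F. \<bar>y - x\<bar> \<le> \<epsilon> *\<^sub>R e"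
  have sub: "subspace F" using F by (simp add: sublattice_def)
  have "z \<in> F" if z: "0 \<le> z" "z \<le> \<bar>x\<bar>" for z
  proof (rule uniformly_closedD[OF F(2) e])
    fix \<epsilon> :: real assume "\<epsilon> > 0"
    then obtain y where y: "y \<in> ideal_core F" "\<bar>y - x\<bar> \<le> \<epsilon> *\<^sub>R e" using approx by blast
    have "inf z \<bar>y\<bar> \<in> F" using y(1) z by (simp add: mem_ideal_core_iff[OF sub])
    moreover have "\<bar>inf z \<bar>y\<bar> - z\<bar> \<le> \<epsilon> *\<^sub>R e"
    proof -
      have "\<bar>inf z \<bar>y\<bar> - z\<bar> = pprt (z - \<bar>y\<bar>)" by (simp add: inf_eq_diff_pprt)
      also have "\<dots> \<le> pprt (\<bar>x\<bar> - \<bar>y\<bar>)" using z by simp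
      also have "\<dots> \<le> \<bar>y - x\<bar>"
        using abs_triangle_ineq2[of x y] by (simp add: pprt_def abs_minus_commute)
      finally show ?thesis using y(2) by (rule order_trans)
    qed
    ultimately show "\<exists>y\<in>F. \<bar>y - z\<bar> \<le> \<epsilon> *\<^sub>R e" by blast
  qed
  thus "x \<in> ideal_core F" by (simp add: mem_ideal_core_iff[OF sub])
qed

text \<open>The elements that become disjoint from \<open>x\<close> in the quotient by the ideal \<open>J\<close>. The quotient
itself is never formed.\<close>

definition relative_polar :: "'a::vector_lattice set \<Rightarrow> 'a \<Rightarrow> 'a set" where
  "relative_polar J x = {y. inf \<bar>y\<bar> x \<in> J}"

lemma order_ideal_relative_polar:
  assumes J: "order_ideal J" and x: "0 \<le> x"
  shows "order_ideal (relative_polar J x)"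
proof -
  note sub = order_ideal_subspace[OF J]
  have solid: "z \<in> relative_polar J x" if "y \<in> relative_polar J x" "\<bar>z\<bar> \<le> \<bar>y\<bar>" for y z
    using that x order_ideal_le[OF J, of "inf \<bar>y\<bar> x" "inf \<bar>z\<bar> x"]
    by (auto simp: relative_polar_def intro: le_infI1)
  have add: "y + z \<in> relative_polar J x"
    if "y \<in> relative_polar J x" "z \<in> relative_polar J x" for y z
  proof -
    have "inf \<bar>y + z\<bar> x \<le> inf (\<bar>y\<bar> + \<bar>z\<bar>) x"
      by (intro inf_mono abs_triangle_ineq order_refl)
    also have "\<dots> \<le> inf \<bar>y\<bar> x + inf \<bar>z\<bar> x" using x by (intro inf_add_le) auto
    finally show ?thesis
      using that x subspace_add[OF sub] order_ideal_le[OF J]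
      unfolding relative_polar_def by (metis (no_types, lifting) abs_ge_zero inf.boundedI mem_Collect_eq)
  qed
  have "subspace (relative_polar J x)"
  proof (rule subspaceI)
    show "0 \<in> relative_polar J x"
      using x subspace_0[OF sub] by (simp add: relative_polar_def inf_absorb1)
  next
    fix c :: real and y assume y: "y \<in> relative_polar J x"
    define d where "d = \<bar>c\<bar> + 1"
    have d: "d \<ge> 1" "\<bar>c\<bar> \<le> d" by (auto simp: d_def)
    have "inf \<bar>c *\<^sub>R y\<bar> x \<le> d *\<^sub>R inf \<bar>y\<bar> x"
    proof -
      have "inf \<bar>c *\<^sub>R y\<bar> x \<le> inf (d *\<^sub>R \<bar>y\<bar>) (d *\<^sub>R x)"
        using d x scaleR_right_mono[of 1 d x]
        by (intro inf_mono) (auto simp: abs_scaleR_lattice intro: scaleR_right_mono)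
      also have "\<dots> = d *\<^sub>R inf \<bar>y\<bar> x"
        using d by (simp add: scaleR_inf_nonneg)
      finally show ?thesis .
    qed
    moreover have "d *\<^sub>R inf \<bar>y\<bar> x \<in> J"
      using y by (simp add: relative_polar_def subspace_scale[OF sub])
    ultimately show "c *\<^sub>R y \<in> relative_polar J x"
      using x order_ideal_le[OF J] by (simp add: relative_polar_def)
  qed (rule add)
  with solid show ?thesis by (auto simp: order_ideal_def)
qed

lemma uniformly_closed_relative_polar:
  assumes J: "order_ideal J" "uniformly_closed J" and x: "0 \<le> x"
  shows "uniformly_closed (relative_polar J x)"
  unfolding uniformly_closed_iff_approx
proof (intro allI impI)
  fix e w :: 'a
  assume e: "0 \<le> e"
    and approx: "\<forall>\<epsilon>>0. \<exists>z\<in>relative_polar J x. \<bar>z - w\<bar> \<le> \<epsilon> *\<^sub>R e"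
  have le: "inf \<bar>u\<bar> x - inf \<bar>v\<bar> x \<le> \<bar>u - v\<bar>" for u v
  proof -
    have "inf \<bar>u\<bar> x \<le> inf (\<bar>v\<bar> + \<bar>u - v\<bar>) (x + \<bar>u - v\<bar>)"
      using abs_triangle_ineq2[of u v] by (intro inf_mono) (auto simp: algebra_simps)
    thus ?thesis by (simp add: diff_le_eq add.commute flip: add_inf_distrib_right)
  qed
  have "inf \<bar>w\<bar> x \<in> J"
  proof (rule uniformly_closedD[OF J(2) e])
    fix \<epsilon> :: real assume "\<epsilon> > 0"
    then obtain z where z: "z \<in> relative_polar J x" "\<bar>z - w\<bar> \<le> \<epsilon> *\<^sub>R e"
      using approx by blast
    have "\<bar>inf \<bar>z\<bar> x - inf \<bar>w\<bar> x\<bar> \<le> \<bar>z - w\<bar>"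
      using le[of z w] le[of w z] by (intro abs_leI) (simp_all only: minus_diff_eq abs_minus_commute)
    with z show "\<exists>y\<in>J. \<bar>y - inf \<bar>w\<bar> x\<bar> \<le> \<epsilon> *\<^sub>R e"
      by (auto simp: relative_polar_def intro: order_trans)
  qed
  thus "w \<in> relative_polar J x" by (simp add: relative_polar_def)
qed

section \<open>Lattice homomorphisms from prime ideals\<close>

text \<open>Real-valued lattice homomorphisms, that is, linear functionals that preserve the modulus; they
then preserve finite suprema and infima.\<close>

definition lattice_hom :: "('a::vector_lattice \<Rightarrow> real) \<Rightarrow> bool" where
  "lattice_hom h \<longleftrightarrow> linear h \<and> (\<forall>x. h \<bar>x\<bar> = \<bar>h x\<bar>)"

lemma lattice_hom_linear: "lattice_hom h \<Longrightarrow> linear h"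
  by (simp add: lattice_hom_def)

lemma lattice_hom_abs: "lattice_hom h \<Longrightarrow> h \<bar>x\<bar> = \<bar>h x\<bar>"
  by (simp add: lattice_hom_def)

lemma lattice_hom_nonneg: "lattice_hom h \<Longrightarrow> 0 \<le> x \<Longrightarrow> 0 \<le> h x"
  by (metis abs_ge_zero abs_of_nonneg lattice_hom_abs)

lemma lattice_hom_mono:
  assumes "lattice_hom h" "x \<le> y"
  shows "h x \<le> h y"
  using lattice_hom_nonneg[of h "y - x"] assms by (simp add: lattice_hom_linear linear_diff)

lemma lattice_hom_pprt: "lattice_hom h \<Longrightarrow> h (pprt x) = max (h x) 0"
  by (simp add: pprt_eq_half linear_scale linear_add lattice_hom_linear lattice_hom_abs)

lemma lattice_hom_sup: "lattice_hom h \<Longrightarrow> h (sup x y) = max (h x) (h y)"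
  by (simp add: sup_eq_add_pprt linear_add linear_diff lattice_hom_linear lattice_hom_pprt)

lemma lattice_hom_inf: "lattice_hom h \<Longrightarrow> h (inf x y) = min (h x) (h y)"
  by (simp add: inf_eq_diff_pprt linear_diff lattice_hom_linear lattice_hom_pprt)

text \<open>A proper uniformly closed prime ideal \<open>P\<close> has a one-dimensional quotient. For every real \<open>t\<close>
one of the positive parts of \<open>t *\<^sub>R x - y\<close> and \<open>y - t *\<^sub>R x\<close> lies in \<open>P\<close>, so that modulo
\<open>P\<close> the element \<open>y\<close> cuts the multiples of \<open>x\<close> in the sense of Dedekind. Closedness makes
the cut proper, since otherwise \<open>x\<close> would be infinitely small compared with \<open>\<bar>y\<bar>\<close> modulo \<open>P\<close> and
hence in \<open>P\<close>; it also shows that \<open>y\<close> equals the corresponding multiple of \<open>x\<close> modulo \<open>P\<close>.\<close>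

lemma prime_ideal_lattice_hom:
  assumes P: "order_ideal P" "uniformly_closed P"
    and x: "0 \<le> x" "x \<notin> P"
    and prime: "\<And>u v. 0 \<le> u \<Longrightarrow> 0 \<le> v \<Longrightarrow> inf u v = 0 \<Longrightarrow> u \<in> P \<or> v \<in> P"
  obtains h where "lattice_hom h" "\<And>y. h y = 0 \<longleftrightarrow> y \<in> P"
proof -
  note sub = order_ideal_subspace[OF P(1)]
  have below: "\<exists>t. pprt (t *\<^sub>R x - y) \<notin> P" for y
  proof (rule ccontr)
    assume "\<not> ?thesis"
    hence all: "pprt (t *\<^sub>R x - y) \<in> P" for t by blast
    have "x \<in> P"
    proof (rule order_ideal_approx[OF P abs_ge_zero[of y] x(1)])
      fix \<epsilon> :: real assume "\<epsilon> > 0"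
      have "x - \<epsilon> *\<^sub>R \<bar>y\<bar> \<le> x - \<epsilon> *\<^sub>R y"
        using \<open>\<epsilon> > 0\<close> by (simp add: scaleR_left_mono abs_ge_self)
      also have "\<dots> = \<epsilon> *\<^sub>R (inverse \<epsilon> *\<^sub>R x - y)"
        using \<open>\<epsilon> > 0\<close> by (simp add: scaleR_diff_right)
      finally have "pprt (x - \<epsilon> *\<^sub>R \<bar>y\<bar>) \<le> pprt (\<epsilon> *\<^sub>R (inverse \<epsilon> *\<^sub>R x - y))" by simp
      also have "\<dots> = \<epsilon> *\<^sub>R pprt (inverse \<epsilon> *\<^sub>R x - y)"
        using \<open>\<epsilon> > 0\<close> scaleR_sup_nonneg[of \<epsilon> "inverse \<epsilon> *\<^sub>R x - y" 0]
        by (simp add: pprt_def)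
      finally show "pprt (x - \<epsilon> *\<^sub>R \<bar>y\<bar>) \<in> P"
        by (intro order_ideal_le[OF P(1) subspace_scale[OF sub all]]) auto
    qed
    with x(2) show False by contradiction
  qed
  have above: "\<exists>t. pprt (y - t *\<^sub>R x) \<notin> P" for y
  proof -
    obtain t where "pprt (t *\<^sub>R x - (- y)) \<notin> P" using below by blast
    thus ?thesis by (intro exI[of _ "- t"]) (simp add: add.commute)
  qed
  have dich: "pprt (t *\<^sub>R x - y) \<in> P \<or> pprt (y - t *\<^sub>R x) \<in> P" for t y
    by (intro prime zero_le_pprt inf_pprt_diff_diff)
  have ex: "\<exists>s. y - s *\<^sub>R x \<in> P" for y
  proof -
    define S where "S = {t. pprt (t *\<^sub>R x - y) \<in> P}"
    have down: "t \<in> S" if "t' \<in> S" "t \<le> t'" for t t'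
    proof -
      have "pprt (t *\<^sub>R x - y) \<le> pprt (t' *\<^sub>R x - y)"
        using that x(1) by (intro pprt_mono diff_right_mono scaleR_right_mono)
      thus ?thesis using that order_ideal_le[OF P(1)] by (simp add: S_def)
    qed
    obtain t0 where "pprt (y - t0 *\<^sub>R x) \<notin> P" using above by blast
    with dich have ne: "S \<noteq> {}" by (auto simp: S_def)
    obtain t1 where "t1 \<notin> S" using below by (auto simp: S_def)
    with down have bdd: "bdd_above S" by (intro bdd_aboveI[of _ t1]) (meson linear)
    define s where "s = Sup S"
    have "\<bar>y - s *\<^sub>R x\<bar> \<in> P"
    proof (rule order_ideal_approx[OF P x(1) abs_ge_zero])
      fix \<epsilon> :: real assume "\<epsilon> > 0"
      define w where "w = y - s *\<^sub>R x"
      have "s + \<epsilon> \<notin> S" using cSup_upper[OF _ bdd, of "s + \<epsilon>"] \<open>\<epsilon> > 0\<close> by (auto simp: s_def)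
      with dich have "pprt (y - (s + \<epsilon>) *\<^sub>R x) \<in> P" by (auto simp: S_def)
      hence 1: "pprt (w - \<epsilon> *\<^sub>R x) \<in> P" by (simp add: w_def algebra_simps)
      have "\<exists>t\<in>S. s - \<epsilon> < t" using less_cSupE[of "s - \<epsilon>" S] ne \<open>\<epsilon> > 0\<close> by (auto simp: s_def)
      hence "s - \<epsilon> \<in> S" using down by (meson less_imp_le)
      hence 2: "pprt (- w - \<epsilon> *\<^sub>R x) \<in> P" by (simp add: S_def w_def algebra_simps)
      have "pprt (\<bar>w\<bar> - \<epsilon> *\<^sub>R x) = sup (pprt (w - \<epsilon> *\<^sub>R x)) (pprt (- w - \<epsilon> *\<^sub>R x))"
        unfolding pprt_def abs_lattice[of w] diff_conv_add_uminus add_sup_distrib_right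
        by (simp add: sup_aci)
      also have "\<dots> \<le> pprt (w - \<epsilon> *\<^sub>R x) + pprt (- w - \<epsilon> *\<^sub>R x)" by simp
      finally show "pprt (\<bar>y - s *\<^sub>R x\<bar> - \<epsilon> *\<^sub>R x) \<in> P"
        unfolding w_def[symmetric]
        by (intro order_ideal_le[OF P(1) subspace_add[OF sub 1 2]]) auto
    qed
    thus ?thesis using order_ideal_abs_iff[OF P(1)] by blast
  qed
  then obtain h where h: "\<And>y. y - h y *\<^sub>R x \<in> P" by metis
  have uniq: "h y = a" if "y - a *\<^sub>R x \<in> P" for y a
  proof (rule ccontr)
    assume "h y \<noteq> a"
    have "(y - a *\<^sub>R x) - (y - h y *\<^sub>R x) \<in> P" using that h by (rule subspace_diff[OF sub])
    hence "(h y - a) *\<^sub>R x \<in> P" by (simp add: scaleR_diff_left)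
    hence "inverse (h y - a) *\<^sub>R (h y - a) *\<^sub>R x \<in> P" by (rule subspace_scale[OF sub])
    with \<open>h y \<noteq> a\<close> x(2) show False by simp
  qed
  have "linear h"
  proof (rule linearI)
    fix y z c
    have "(y - h y *\<^sub>R x) + (z - h z *\<^sub>R x) \<in> P" by (intro subspace_add[OF sub] h)
    thus "h (y + z) = h y + h z" by (intro uniq) (simp add: algebra_simps)
    have "c *\<^sub>R (y - h y *\<^sub>R x) \<in> P" by (intro subspace_scale[OF sub] h)
    thus "h (c *\<^sub>R y) = c *\<^sub>R h y" by (intro uniq) (simp add: algebra_simps)
  qed
  moreover have "h \<bar>y\<bar> = \<bar>h y\<bar>" for y
  proof (rule uniq, rule order_idealD[OF P(1) h[of y]])
    have "\<bar>h y *\<^sub>R x\<bar> = \<bar>h y\<bar> *\<^sub>R x" using x(1) by (simp add: abs_scaleR_lattice)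
    thus "\<bar>\<bar>y\<bar> - \<bar>h y\<bar> *\<^sub>R x\<bar> \<le> \<bar>y - h y *\<^sub>R x\<bar>"
      using abs_triangle_ineq3[of y "h y *\<^sub>R x"] by simp
  qed
  ultimately have "lattice_hom h" by (simp add: lattice_hom_def)
  moreover have "h y = 0 \<longleftrightarrow> y \<in> P" for y
    using h[of y] uniq[of y 0] by auto
  ultimately show thesis by (rule that)
qed

section \<open>Disjoint families and finite codimension\<close>

text \<open>A homogeneous linear system with fewer equations (indexed by \<open>J\<close>) than unknowns (indexed by
\<open>I\<close>) has a nontrivial solution; the induction eliminates one unknown.\<close>

lemma homogeneous_system_nontrivial:
  fixes a :: "'i \<Rightarrow> 'j \<Rightarrow> real"
  assumes "finite J" "finite I" "card J < card I"
  shows "\<exists>c. (\<exists>i\<in>I. c i \<noteq> 0) \<and> (\<forall>j\<in>J. (\<Sum>i\<in>I. c i * a i j) = 0)"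
  using assms
proof (induction J arbitrary: I a rule: finite_induct)
  case empty
  hence "I \<noteq> {}" by auto
  thus ?case by (intro exI[of _ "\<lambda>_. 1"]) auto
next
  case (insert k J)
  show ?case
  proof (cases "\<exists>p\<in>I. a p k \<noteq> 0")
    case False
    obtain c where "\<exists>i\<in>I. c i \<noteq> 0" "\<forall>j\<in>J. (\<Sum>i\<in>I. c i * a i j) = 0"
      using insert.IH[of I a] insert.prems insert.hyps by auto
    with False show ?thesis by (intro exI[of _ c]) auto
  next
    case True
    then obtain p where p: "p \<in> I" "a p k \<noteq> 0" by blast
    define a' where "a' i j = a i j - a i k / a p k * a p j" for i j
    have "card J < card (I - {p})" using insert.prems insert.hyps p by simp
    then obtain c where c: "\<exists>i\<in>I - {p}. c i \<noteq> 0" "\<forall>j\<in>J. (\<Sum>i\<in>I - {p}. c i * a' i j) = 0"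
      using insert.IH[of "I - {p}" a'] insert.prems by auto
    define d where "d i = (if i = p then - (\<Sum>i\<in>I - {p}. c i * a i k) / a p k else c i)" for i
    have "(\<Sum>i\<in>I. d i * a i j) = (\<Sum>i\<in>I - {p}. c i * a' i j)" for j
    proof -
      have "(\<Sum>i\<in>I. d i * a i j) = d p * a p j + (\<Sum>i\<in>I - {p}. d i * a i j)"
        using p insert.prems by (simp add: sum.remove)
      also have "(\<Sum>i\<in>I - {p}. d i * a i j) = (\<Sum>i\<in>I - {p}. c i * a i j)"
        by (intro sum.cong) (auto simp: d_def)
      also have "d p * a p j = - (\<Sum>i\<in>I - {p}. c i * (a i k / a p k * a p j))"
        by (simp add: d_def sum_distrib_right sum_divide_distrib mult.assoc)
      also have "\<dots> + (\<Sum>i\<in>I - {p}. c i * a i j) = (\<Sum>i\<in>I - {p}. c i * a' i j)"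
        by (simp add: a'_def algebra_simps sum_subtractf)
      finally show ?thesis .
    qed
    moreover have "a' i k = 0" for i using p by (simp add: a'_def)
    moreover have "\<exists>i\<in>I. d i \<noteq> 0" using c(1) by (auto simp: d_def)
    ultimately show ?thesis using c(2) by (intro exI[of _ d]) auto
  qed
qed

text \<open>More than \<open>n\<close> vectors are linearly dependent modulo a subspace of codimension \<open>n\<close>. Families
instead of sets allow repeated vectors.\<close>

lemma codimension_combination:
  fixes w :: "'i \<Rightarrow> 'a::real_vector"
  assumes F: "has_codimension F n" and I: "finite I" "n < card I"
  shows "\<exists>c. (\<exists>i\<in>I. c i \<noteq> 0) \<and> (\<Sum>i\<in>I. c i *\<^sub>R w i) \<in> F"
proof -
  have sub: "subspace F" using F by (simp add: has_codimension_def)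
  obtain b where "\<forall>x. \<exists>c. x - (\<Sum>j<n. c j *\<^sub>R b j) \<in> F"
    using F by (auto simp: has_codimension_def coset_eq_iff)
  then obtain a where a: "\<And>x. x - (\<Sum>j<n. a x j *\<^sub>R b j) \<in> F" by metis
  obtain c where c: "\<exists>i\<in>I. c i \<noteq> 0" "\<forall>j\<in>{..<n}. (\<Sum>i\<in>I. c i * a (w i) j) = 0"
    using homogeneous_system_nontrivial[of "{..<n}" I "\<lambda>i. a (w i)"] I by auto
  have "(\<Sum>i\<in>I. c i *\<^sub>R (\<Sum>j<n. a (w i) j *\<^sub>R b j))
      = (\<Sum>j<n. (\<Sum>i\<in>I. c i * a (w i) j) *\<^sub>R b j)"
    unfolding scaleR_sum_right scaleR_sum_left scaleR_scaleR by (rule sum.swap)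
  also have "\<dots> = 0" using c(2) by simp
  finally have "(\<Sum>i\<in>I. c i *\<^sub>R w i)
      = (\<Sum>i\<in>I. c i *\<^sub>R (w i - (\<Sum>j<n. a (w i) j *\<^sub>R b j)))"
    by (simp add: scaleR_diff_right sum_subtractf)
  also have "\<dots> \<in> F" by (intro subspace_sum[OF sub] subspace_scale[OF sub] a)
  finally show ?thesis using c(1) by blast
qed

text \<open>For disjoint positive vectors the positive part of a linear combination is the combination with
the positive parts of the coefficients, so the dependence can be taken with nonnegative
coefficients.\<close>

lemma disjoint_positive_combination:
  fixes y :: "'i \<Rightarrow> 'a::vector_lattice"
  assumes F: "sublattice F" "has_codimension F n" and I: "finite I" "n < card I"
    and pos: "\<And>i. i \<in> I \<Longrightarrow> 0 \<le> y i"
    and disj: "\<And>i k. i \<in> I \<Longrightarrow> k \<in> I \<Longrightarrow> i \<noteq> k \<Longrightarrow> inf (y i) (y k) = 0"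
  shows "\<exists>c p. (\<forall>i. 0 \<le> c i) \<and> p \<in> I \<and> 0 < c p \<and> (\<Sum>i\<in>I. c i *\<^sub>R y i) \<in> F"
proof -
  have sub: "subspace F" using F by (simp add: sublattice_def)
  obtain c0 p where c0: "p \<in> I" "c0 p \<noteq> 0" "(\<Sum>i\<in>I. c0 i *\<^sub>R y i) \<in> F"
    using codimension_combination[OF F(2) I] by blast
  \<comment> \<open>Normalise the sign so that at least one coefficient is positive.\<close>
  define c where "c i = sgn (c0 p) * c0 i" for i
  have "(\<Sum>i\<in>I. c i *\<^sub>R y i) = sgn (c0 p) *\<^sub>R (\<Sum>i\<in>I. c0 i *\<^sub>R y i)"
    by (simp add: c_def scaleR_sum_right)
  hence c: "0 < c p" "(\<Sum>i\<in>I. c i *\<^sub>R y i) \<in> F"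
    using c0 by (auto simp: c_def subspace_scale[OF sub] sgn_if)
  define P where "P = (\<Sum>i\<in>I. max (c i) 0 *\<^sub>R y i)"
  define N where "N = (\<Sum>i\<in>I. max (- c i) 0 *\<^sub>R y i)"
  have "max (c i) 0 *\<^sub>R y i - max (- c i) 0 *\<^sub>R y i = c i *\<^sub>R y i" for i
    by (auto simp: max_def simp flip: scaleR_diff_left)
  hence PN: "P - N = (\<Sum>i\<in>I. c i *\<^sub>R y i)"
    unfolding P_def N_def by (simp flip: sum_subtractf)
  have "inf P N = 0"
    unfolding P_def N_def
  proof (rule disjoint_sum_sum)
    fix i k assume ik: "i \<in> I" "k \<in> I"
    show "inf (max (c i) 0 *\<^sub>R y i) (max (- c k) 0 *\<^sub>R y k) = 0"
    proof (cases "i = k")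
      case True
      have nn: "0 \<le> max r 0 *\<^sub>R y k" for r using pos ik by (simp add: scaleR_nonneg_nonneg)
      have "max (c k) 0 = 0 \<or> max (- c k) 0 = 0" by auto
      thus ?thesis using True nn inf_absorb1 inf_absorb2 by (metis scaleR_zero_left)
    qed (use ik disj in \<open>auto intro: disjoint_scaleR\<close>)
  qed (use I pos in \<open>auto intro: scaleR_nonneg_nonneg\<close>)
  hence "P = pprt (P - N)" by (simp add: inf_eq_diff_pprt)
  hence "P \<in> F" using sublattice_pprt[OF F(1) c(2)] by (simp add: PN)
  thus ?thesis
    unfolding P_def using c(1) c0(1)
    by (intro exI[of _ "\<lambda>i. max (c i) 0"] exI[of _ p]) auto
qed

text \<open>Each row of the array contributes a nonnegative combination in \<open>F\<close>, with a positive coefficient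
at some entry, called the pivot of the row. A nonnegative combination of the pivots that lies in
\<open>F\<close> has infimum, with a large multiple of the combination of one row, equal to a multiple of the
pivot of that row.\<close>

lemma disjoint_array_meets_sublattice:
  fixes y :: "nat \<Rightarrow> nat \<Rightarrow> 'a::vector_lattice"
  assumes F: "sublattice F" "has_codimension F n"
    and pos: "\<And>k l. k \<le> n \<Longrightarrow> l \<le> n \<Longrightarrow> 0 \<le> y k l"
    and disj: "\<And>k l k' l'. k \<le> n \<Longrightarrow> l \<le> n \<Longrightarrow> k' \<le> n \<Longrightarrow> l' \<le> n \<Longrightarrow>
      (k, l) \<noteq> (k', l') \<Longrightarrow> inf (y k l) (y k' l') = 0"
  shows "\<exists>k\<le>n. \<exists>l\<le>n. y k l \<in> F"
proof -
  have sub: "subspace F" using F by (simp add: sublattice_def)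
  have "\<exists>c p. (\<forall>l. 0 \<le> c l) \<and> p \<in> {..n} \<and> 0 < c p \<and> (\<Sum>l\<in>{..n}. c l *\<^sub>R y k l) \<in> F"
    if "k \<le> n" for k
    by (rule disjoint_positive_combination[OF F]) (use that pos disj in auto)
  then obtain c p where c: "\<And>k l. k \<le> n \<Longrightarrow> 0 \<le> (c k l :: real)"
      "\<And>k. k \<le> n \<Longrightarrow> p k \<le> n" "\<And>k. k \<le> n \<Longrightarrow> 0 < c k (p k)"
      "\<And>k. k \<le> n \<Longrightarrow> (\<Sum>l\<le>n. c k l *\<^sub>R y k l) \<in> F"
    unfolding atMost_iff by metis
  have "\<exists>d q. (\<forall>k. 0 \<le> d k) \<and> q \<in> {..n} \<and> 0 < d q \<and> (\<Sum>k\<in>{..n}. d k *\<^sub>R y k (p k)) \<in> F"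
    by (rule disjoint_positive_combination[OF F]) (use c pos disj in auto)
  then obtain d q where d: "\<And>k. 0 \<le> (d k :: real)" "q \<le> n" "0 < d q"
      "(\<Sum>k\<le>n. d k *\<^sub>R y k (p k)) \<in> F" by auto
  \<comment> \<open>Scaled by \<open>M\<close>, row \<open>q\<close> has the same coefficient at its pivot as the combination of
    pivots; the remainders \<open>R\<close> and \<open>R'\<close> share no index and are disjoint.\<close>
  define M where "M = d q / c q (p q)"
  have M: "0 < M" "M * c q (p q) = d q" using c(3)[OF d(2)] d(3) by (auto simp: M_def)
  define z where "z = d q *\<^sub>R y q (p q)"
  define R where "R = (\<Sum>k\<in>{..n} - {q}. d k *\<^sub>R y k (p k))"
  define R' where "R' = (\<Sum>l\<in>{..n} - {p q}. (M * c q l) *\<^sub>R y q l)"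
  have 1: "(\<Sum>k\<le>n. d k *\<^sub>R y k (p k)) = z + R"
    using d(2) unfolding z_def R_def by (subst sum.remove[of _ q]) auto
  have "M *\<^sub>R (\<Sum>l\<le>n. c q l *\<^sub>R y q l) = (\<Sum>l\<le>n. (M * c q l) *\<^sub>R y q l)"
    by (simp add: scaleR_sum_right)
  also have "\<dots> = z + R'"
    using c(2)[OF d(2)] M(2) unfolding z_def R'_def by (subst sum.remove[of _ "p q"]) auto
  finally have "z + R' \<in> F" using subspace_scale[OF sub c(4)[OF d(2)], of M] by simp
  with d(4) F(1) have "inf (z + R) (z + R') \<in> F" by (simp add: 1 sublattice_def)
  moreover have "inf R R' = 0"
    unfolding R_def R'_def
  proof (rule disjoint_sum_sum)
    fix k l assume k: "k \<in> {..n} - {q}" and l: "l \<in> {..n} - {p q}"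
    have "inf (y k (p k)) (y q l) = 0" by (rule disj) (use k l c(2) d(2) in auto)
    thus "inf (d k *\<^sub>R y k (p k)) ((M * c q l) *\<^sub>R y q l) = 0"
      by (rule disjoint_scaleR) (use d(1) M(1) c(1)[OF d(2)] in simp_all)
  next
    fix k assume "k \<in> {..n} - {q}"
    thus "0 \<le> d k *\<^sub>R y k (p k)" using d(1) pos c(2) by (simp add: scaleR_nonneg_nonneg)
  next
    fix l assume "l \<in> {..n} - {p q}"
    thus "0 \<le> (M * c q l) *\<^sub>R y q l"
      using d(2) M(1) pos c(1) by (simp add: scaleR_nonneg_nonneg)
  qed simp_all
  ultimately have "z \<in> F" by (simp flip: add_inf_distrib_left)
  hence "inverse (d q) *\<^sub>R z \<in> F" by (rule subspace_scale[OF sub])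
  hence "y q (p q) \<in> F" using d(3) by (simp add: z_def)
  thus ?thesis using c(2) d(2) by blast
qed

text \<open>\<open>x 0, \<dots>, x (m - 1)\<close> are positive, pairwise disjoint and outside \<open>J\<close>.\<close>

definition disjoint_family_off :: "'a::vector_lattice set \<Rightarrow> nat \<Rightarrow> (nat \<Rightarrow> 'a) \<Rightarrow> bool" where
  "disjoint_family_off J m x \<longleftrightarrow>
     (\<forall>i<m. 0 \<le> x i \<and> x i \<notin> J) \<and> (\<forall>i<m. \<forall>k<m. i \<noteq> k \<longrightarrow> inf (x i) (x k) = 0)"

text \<open>The bound is not optimal, but any bound yields a family of maximal length.\<close>

lemma disjoint_family_off_ideal_core_bound:
  assumes F: "sublattice F" "has_codimension F n"
    and x: "disjoint_family_off (ideal_core F) m x"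
  shows "m < Suc n * Suc n"
proof (rule ccontr)
  assume m: "\<not> m < Suc n * Suc n"
  have sub: "subspace F" using F by (simp add: sublattice_def)
  have "\<exists>y. 0 \<le> y \<and> y \<le> x i \<and> y \<notin> F" if "i < m" for i
  proof -
    have "0 \<le> x i" "x i \<notin> ideal_core F" using x that by (auto simp: disjoint_family_off_def)
    thus ?thesis by (auto simp: mem_ideal_core_iff[OF sub])
  qed
  then obtain y where y: "\<And>i. i < m \<Longrightarrow> 0 \<le> y i" "\<And>i. i < m \<Longrightarrow> y i \<le> x i"
      "\<And>i. i < m \<Longrightarrow> y i \<notin> F" by metis
  \<comment> \<open>Arrange the first \<open>(n + 1)\<^sup>2\<close> indices in a square.\<close>
  define \<iota> where "\<iota> k l = k * Suc n + l" for k l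
  have idx: "\<iota> k l < m" if "k \<le> n" "l \<le> n" for k l
  proof -
    have "\<iota> k l < Suc k * Suc n" using that by (simp add: \<iota>_def)
    also have "\<dots> \<le> Suc n * Suc n" using that by (intro mult_le_mono1) simp
    finally show ?thesis using m by linarith
  qed
  have idx_inj: "k = k' \<and> l = l'" if "\<iota> k l = \<iota> k' l'" "l \<le> n" "l' \<le> n" for k k' l l'
  proof -
    have "\<iota> k l div Suc n = k" "\<iota> k' l' div Suc n = k'"
      unfolding \<iota>_def using that(2,3) by (subst div_mult_self3; simp)+
    with that(1) have "k = k'" by (simp only:)
    with that(1) show ?thesis by (simp add: \<iota>_def)
  qed
  have "\<exists>k\<le>n. \<exists>l\<le>n. y (\<iota> k l) \<in> F"
  proof (rule disjoint_array_meets_sublattice[OF F])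
    fix k l assume "k \<le> n" "l \<le> n"
    thus "0 \<le> y (\<iota> k l)" by (intro y(1) idx)
  next
    fix k l k' l' assume kl: "k \<le> n" "l \<le> n" "k' \<le> n" "l' \<le> n" "(k, l) \<noteq> (k', l')"
    note i = idx[OF kl(1,2)] idx[OF kl(3,4)]
    have "\<iota> k l \<noteq> \<iota> k' l'" using idx_inj kl by blast
    hence "inf (x (\<iota> k l)) (x (\<iota> k' l')) = 0"
      using x i by (simp add: disjoint_family_off_def)
    from disjoint_mono[OF this y(1)[OF i(1)] y(2)[OF i(1)] y(1)[OF i(2)] y(2)[OF i(2)]]
    show "inf (y (\<iota> k l)) (y (\<iota> k' l')) = 0" .
  qed
  then obtain k l where "k \<le> n" "l \<le> n" "y (\<iota> k l) \<in> F" by blast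
  with y(3)[OF idx] show False by simp
qed

lemma disjoint_family_offI:
  assumes "\<And>i. i < m \<Longrightarrow> 0 \<le> x i" "\<And>i. i < m \<Longrightarrow> x i \<notin> J"
    and lt: "\<And>i k. i < k \<Longrightarrow> k < m \<Longrightarrow> inf (x k) (x i) = 0"
  shows "disjoint_family_off J m x"
proof -
  have "inf (x i) (x k) = 0" if "i < m" "k < m" "i \<noteq> k" for i k
    using that lt[of i k] lt[of k i] by (metis inf_commute linorder_neqE_nat)
  with assms(1,2) show ?thesis by (simp add: disjoint_family_off_def)
qed

text \<open>If the length of the family is maximal, then each \<open>relative_polar J (x i)\<close> is prime: two disjoint
elements outside it would produce two disjoint elements below \<open>x i\<close>, outside \<open>J\<close>, that could
replace \<open>x i\<close>. An element \<open>y\<close> outside \<open>J\<close> in all these polars could be made disjoint from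
the family and added to it.\<close>

lemma maximal_disjoint_family_lattice_homs:
  assumes J: "order_ideal J" "uniformly_closed J"
    and x: "disjoint_family_off J m x"
    and max: "\<And>x'. \<not> disjoint_family_off J (Suc m) x'"
  shows "\<exists>H. finite H \<and> (\<forall>h\<in>H. lattice_hom h) \<and> (\<forall>y. (\<forall>h\<in>H. h y = 0) \<longrightarrow> y \<in> J)"
proof -
  note sub = order_ideal_subspace[OF J(1)]
  have pos: "0 \<le> x i" and out: "x i \<notin> J" if "i < m" for i
    using x that by (auto simp: disjoint_family_off_def)
  have disj: "inf (x i) (x k) = 0" if "i < m" "k < m" "i \<noteq> k" for i k
    using x that by (auto simp: disjoint_family_off_def)
  have "\<exists>h. lattice_hom h \<and> (\<forall>y. h y = 0 \<longleftrightarrow> y \<in> relative_polar J (x i))" if i: "i < m" for i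
  proof -
    have prime: "u \<in> relative_polar J (x i) \<or> v \<in> relative_polar J (x i)"
      if uv: "0 \<le> u" "0 \<le> v" "inf u v = 0" for u v
    proof (rule ccontr)
      assume "\<not> ?thesis"
      hence n: "inf u (x i) \<notin> J" "inf v (x i) \<notin> J"
        using uv by (auto simp: relative_polar_def)
      define x' where "x' = x(i := inf u (x i), m := inf v (x i))"
      have "disjoint_family_off J (Suc m) x'"
      proof (rule disjoint_family_offI)
        fix k assume "k < Suc m"
        thus "0 \<le> x' k" using pos i uv by (cases "k = m"; cases "k = i") (simp_all add: x'_def)
        show "x' k \<notin> J" using \<open>k < Suc m\<close> out n
          by (cases "k = m"; cases "k = i") (simp_all add: x'_def)
      next
        fix k l assume kl: "k < l" "l < Suc m"
        have 1: "inf (inf u (x i)) (inf v (x i)) = 0"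
          by (rule disjoint_mono[OF uv(3)]) (use uv pos[OF i] in auto)
        have 2: "inf (inf w (x i)) (x j) = 0" if "0 \<le> w" "j < m" "j \<noteq> i" for w j
          by (rule disjoint_mono[OF disj[OF i that(2)]]) (use that pos i in auto)
        show "inf (x' l) (x' k) = 0"
        proof (cases "l = m")
          case True
          thus ?thesis using 1 2[OF uv(2)] kl i
            by (cases "k = i") (simp_all add: x'_def inf_commute[of "inf v _" "inf u _"])
        next
          case False
          have "inf (x' l) (x' k) = inf (x' k) (x' l)" by (rule inf_commute)
          thus ?thesis using 2[OF uv(1)] disj kl i False
            by (cases "k = i"; cases "l = i") (simp_all add: x'_def)
        qed
      qed
      with max show False by blast
    qed
    have "x i \<notin> relative_polar J (x i)" using pos out i by (simp add: relative_polar_def)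
    show ?thesis
    proof (rule prime_ideal_lattice_hom[OF order_ideal_relative_polar[OF J(1) pos[OF i]]
          uniformly_closed_relative_polar[OF J pos[OF i]] pos[OF i] \<open>x i \<notin> _\<close> prime])
      fix h assume "lattice_hom h" "\<And>y. h y = 0 \<longleftrightarrow> y \<in> relative_polar J (x i)"
      thus ?thesis by blast
    qed
  qed
  then obtain h where h: "\<And>i. i < m \<Longrightarrow> lattice_hom (h i)"
      "\<And>i y. i < m \<Longrightarrow> h i y = 0 \<longleftrightarrow> y \<in> relative_polar J (x i)" by metis
  have "y \<in> J" if "\<forall>i<m. h i y = 0" for y
  proof (rule ccontr)
    assume "y \<notin> J"
    have yJ: "inf (x i) \<bar>y\<bar> \<in> J" if "i < m" for i
      using that h(2) \<open>\<forall>i<m. h i y = 0\<close> by (simp add: relative_polar_def inf_commute)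
    define s where "s = (\<Sum>i<m. x i)"
    have s: "x i \<le> s" if "i < m" for i
    proof -
      have "s = x i + sum x ({..<m} - {i})" unfolding s_def using that by (subst sum.remove[of _ i]) auto
      moreover have "0 \<le> sum x ({..<m} - {i})" using pos by (intro sum_nonneg) auto
      ultimately show ?thesis by simp
    qed
    \<comment> \<open>Both \<open>x i\<close> and \<open>\<bar>y\<bar>\<close> change only by elements of \<open>J\<close> when the common parts
      are removed, so the new elements stay outside \<open>J\<close>.\<close>
    have "inf s \<bar>y\<bar> \<le> (\<Sum>i<m. inf (x i) \<bar>y\<bar>)"
      unfolding s_def using pos by (intro inf_sum_le) auto
    moreover have sum: "(\<Sum>i<m. inf (x i) \<bar>y\<bar>) \<in> J" using yJ by (intro subspace_sum[OF sub]) auto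
    moreover have "0 \<le> s" unfolding s_def using pos by (intro sum_nonneg) auto
    ultimately have "inf s \<bar>y\<bar> \<in> J" by (intro order_ideal_le[OF J(1) sum]) simp_all
    have pJ: "pprt (u - v) \<notin> J" if "inf u v \<in> J" "u \<notin> J" for u v
      using that subspace_add[OF sub, of "inf u v" "pprt (u - v)"] by (auto simp: inf_eq_diff_pprt)
    define x' where "x' = (\<lambda>i. if i < m then pprt (x i - \<bar>y\<bar>) else pprt (\<bar>y\<bar> - s))"
    have "disjoint_family_off J (Suc m) x'"
    proof (rule disjoint_family_offI)
      fix i show "0 \<le> x' i" by (simp add: x'_def)
    next
      fix i assume "i < Suc m"
      have "\<bar>y\<bar> \<notin> J" using \<open>y \<notin> J\<close> order_ideal_abs_iff[OF J(1)] by simp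
      moreover have "inf \<bar>y\<bar> s \<in> J" using \<open>inf s \<bar>y\<bar> \<in> J\<close> by (simp only: inf_commute)
      ultimately have "pprt (\<bar>y\<bar> - s) \<notin> J" by (intro pJ)
      moreover have "pprt (x i - \<bar>y\<bar>) \<notin> J" if "i < m"
        using that by (intro pJ yJ out)
      ultimately show "x' i \<notin> J" by (simp add: x'_def)
    next
      fix i k assume ik: "i < k" "k < Suc m"
      hence "i < m" by simp
      show "inf (x' k) (x' i) = 0"
      proof (cases "k = m")
        case True
        have "inf (pprt (\<bar>y\<bar> - s)) (pprt (x i - \<bar>y\<bar>)) = 0"
          by (rule disjoint_mono[OF inf_pprt_diff_diff[of "\<bar>y\<bar>" "x i"]])
            (simp_all add: s[OF \<open>i < m\<close>] diff_left_mono)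
        thus ?thesis using True \<open>i < m\<close> by (simp add: x'_def)
      next
        case False
        hence "k < m" using ik by simp
        have le: "pprt (x j - \<bar>y\<bar>) \<le> x j" if "j < m" for j
          using pos[OF that] by (simp add: pprt_def algebra_simps)
        have "inf (pprt (x k - \<bar>y\<bar>)) (pprt (x i - \<bar>y\<bar>)) = 0"
          by (rule disjoint_mono[OF disj[OF \<open>k < m\<close> \<open>i < m\<close>]])
            (use le \<open>i < m\<close> \<open>k < m\<close> ik in simp_all)
        thus ?thesis using \<open>i < m\<close> \<open>k < m\<close> by (simp add: x'_def)
      qed
    qed
    with max show False by blast
  qed
  thus ?thesis using h(1) by (intro exI[of _ "h ` {..<m}"]) auto
qed

lemma finite_codimension_lattice_homs:
  assumes F: "sublattice F" "uniformly_closed F" "has_codimension F n"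
  obtains H where "finite H" "\<And>h. h \<in> H \<Longrightarrow> lattice_hom h"
    "\<And>y. (\<And>h. h \<in> H \<Longrightarrow> h y = 0) \<Longrightarrow> y \<in> F"
proof -
  define Q where "Q m \<longleftrightarrow> (\<exists>x. disjoint_family_off (ideal_core F) m x)" for m
  have "Q 0" by (simp add: Q_def disjoint_family_off_def)
  have bound: "k \<le> Suc n * Suc n" if "Q k" for k
    using that disjoint_family_off_ideal_core_bound[OF F(1,3)] less_imp_le
    unfolding Q_def by blast
  define m where "m = Greatest Q"
  have "Q m" unfolding m_def using \<open>Q 0\<close> bound by (rule GreatestI_nat)
  then obtain x where x: "disjoint_family_off (ideal_core F) m x" by (auto simp: Q_def)
  have "k \<le> m" if "Q k" for k
    unfolding m_def using that bound by (rule Greatest_le_nat)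
  hence "\<not> Q (Suc m)" by (meson Suc_n_not_le_n)
  hence "\<not> disjoint_family_off (ideal_core F) (Suc m) x'" for x'
    unfolding Q_def by blast
  from maximal_disjoint_family_lattice_homs[OF order_ideal_ideal_core[OF F(1)]
      uniformly_closed_ideal_core[OF F(1,2)] x this]
  obtain H where H: "finite H" "\<forall>h\<in>H. lattice_hom h"
      "\<forall>y. (\<forall>h\<in>H. h y = 0) \<longrightarrow> y \<in> ideal_core F" by (elim exE conjE)
  show thesis
  proof (rule that)
    show "finite H" by (rule H(1))
    show "lattice_hom h" if "h \<in> H" for h using H(2) that by blast
    show "y \<in> F" if "\<And>h. h \<in> H \<Longrightarrow> h y = 0" for y
      using H(3) that ideal_core_subset by blast
  qed
qed

section \<open>Separation by sublattices of codimension one\<close>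

lemma has_codimension_kernel:
  assumes "linear \<phi>" "\<phi> z \<noteq> (0::real)"
  shows "has_codimension {y. \<phi> y = 0} 1"
proof -
  have sub: "subspace {y. \<phi> y = 0}" using assms(1) by (rule linear_subspace_kernel)
  have 1: "\<forall>x. \<exists>c. x - (\<Sum>i<(1::nat). c i *\<^sub>R z) \<in> {y. \<phi> y = 0}"
  proof
    fix x
    have "\<phi> (x - (\<phi> x / \<phi> z) *\<^sub>R z) = 0"
      using assms by (simp add: linear_diff linear_scale)
    thus "\<exists>c. x - (\<Sum>i<(1::nat). c i *\<^sub>R z) \<in> {y. \<phi> y = 0}"
      by (intro exI[of _ "\<lambda>_. \<phi> x / \<phi> z"]) simp
  qed
  have 2: "\<forall>c. (\<Sum>i<(1::nat). c i *\<^sub>R z) - 0 \<in> {y. \<phi> y = 0} \<longrightarrow> (\<forall>i<1. c i = 0)"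
    using assms by (simp add: linear_scale)
  show ?thesis
    unfolding has_codimension_def coset_eq_iff[OF sub]
    by (rule conjI[OF sub], rule exI[of _ "\<lambda>_. z"], rule conjI[OF 2 1])
qed

lemma lattice_hom_diff_kernel:
  assumes h: "lattice_hom h" and k: "lattice_hom k" and pq: "0 \<le> p" "0 \<le> q"
  shows "sublattice {y. p * k y - q * h y = 0}"
    and "uniformly_closed {y. p * k y - q * h y = 0}"
proof -
  have lin: "linear (\<lambda>y. p * k y - q * h y)"
    using h k by (intro linearI)
      (simp_all add: lattice_hom_linear linear_add linear_scale algebra_simps)
  have "p * k \<bar>y\<bar> - q * h \<bar>y\<bar> = 0" if "p * k y - q * h y = 0" for y
  proof -
    have "p * k y = q * h y" using that by simp
    hence "\<bar>p * k y\<bar> = \<bar>q * h y\<bar>" by (rule arg_cong)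
    thus ?thesis using pq by (simp add: lattice_hom_abs[OF h] lattice_hom_abs[OF k] abs_mult)
  qed
  thus "sublattice {y. p * k y - q * h y = 0}"
    using linear_subspace_kernel[OF lin] by (simp add: sublattice_iff_abs)
  show "uniformly_closed {y. p * k y - q * h y = 0}"
    unfolding uniformly_closed_iff_approx
  proof (intro allI impI)
    fix e x :: 'a
    assume e: "0 \<le> e"
      and approx: "\<forall>\<epsilon>>0. \<exists>y\<in>{y. p * k y - q * h y = 0}. \<bar>y - x\<bar> \<le> \<epsilon> *\<^sub>R e"
    have bound: "\<bar>g (y - x)\<bar> \<le> \<epsilon> * g e" if "lattice_hom g" "\<bar>y - x\<bar> \<le> \<epsilon> *\<^sub>R e" for g y \<epsilon>
      using lattice_hom_mono[OF that] that(1)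
      by (simp add: lattice_hom_abs[OF that(1)] linear_scale[OF lattice_hom_linear[OF that(1)]])
    define C where "C = p * k e + q * h e"
    have "\<bar>p * k x - q * h x\<bar> \<le> 0 + \<epsilon>" if "\<epsilon> > 0" for \<epsilon>
    proof -
      have C: "0 \<le> C" unfolding C_def using pq e h k by (simp add: lattice_hom_nonneg)
      define \<delta> where "\<delta> = \<epsilon> / (C + 1)"
      have \<delta>: "\<delta> > 0" "\<delta> * C \<le> \<epsilon>"
        using C that by (auto simp: \<delta>_def field_simps)
      obtain y where y: "p * k y - q * h y = 0" "\<bar>y - x\<bar> \<le> \<delta> *\<^sub>R e"
        using approx \<delta>(1) by blast
      have "p * k x - q * h x = q * h (y - x) - p * k (y - x)"
        using y(1) by (simp add: linear_diff[OF lattice_hom_linear[OF h]]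
            linear_diff[OF lattice_hom_linear[OF k]] algebra_simps)
      also have "\<bar>\<dots>\<bar> \<le> q * \<bar>h (y - x)\<bar> + p * \<bar>k (y - x)\<bar>"
        using pq abs_triangle_ineq4[of "q * h (y - x)" "p * k (y - x)"] by (simp add: abs_mult)
      also have "\<dots> \<le> q * (\<delta> * h e) + p * (\<delta> * k e)"
        using pq bound[OF h y(2)] bound[OF k y(2)] by (intro add_mono mult_left_mono)
      also have "\<dots> = \<delta> * C" by (simp add: C_def algebra_simps)
      finally show ?thesis using \<delta>(2) by simp
    qed
    hence "\<bar>p * k x - q * h x\<bar> \<le> 0" by (rule field_le_epsilon)
    thus "x \<in> {y. p * k y - q * h y = 0}" by simp
  qed
qed

text \<open>The lattice argument in the proof of the Stone--Weierstrass theorem, for finitely many points.\<close>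

lemma two_point_interpolation:
  assumes F: "sublattice F" and H: "finite H" "\<And>h. h \<in> H \<Longrightarrow> lattice_hom h"
    and interp: "\<And>h k. h \<in> H \<Longrightarrow> k \<in> H \<Longrightarrow> \<exists>w\<in>F. h w = h x \<and> k w = k x"
  shows "\<exists>w\<in>F. \<forall>h\<in>H. h w = h x"
proof (cases "H = {}")
  case True
  thus ?thesis using F by (auto simp: sublattice_def dest: subspace_0)
next
  case False
  have below: "\<exists>w\<in>F. h w = h x \<and> (\<forall>k\<in>K. k w \<le> k x)" if hH: "h \<in> H" and "finite K" "K \<subseteq> H" for h K
    using that(2,3)
  proof (induction K rule: finite_induct)
    case empty
    show ?case using interp[OF hH hH] by blast
  next
    case (insert k K)
    obtain w where w: "w \<in> F" "h w = h x" "\<forall>k\<in>K. k w \<le> k x" using insert by auto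
    obtain v where v: "v \<in> F" "h v = h x" "k v = k x" using interp[OF hH, of k] insert.prems by blast
    have "inf v w \<in> F" using F v w by (simp add: sublattice_def)
    moreover have g: "g (inf v w) = min (g v) (g w)" if "g \<in> H" for g
      using H(2)[OF that] by (rule lattice_hom_inf)
    have "h (inf v w) = h x" using g[OF hH] v w by simp
    moreover have "g (inf v w) \<le> g x" if "g \<in> insert k K" for g
      using g[of g] that insert.prems v w by (auto simp: min_le_iff_disj)
    ultimately show ?case by blast
  qed
  have "\<exists>w\<in>F. (\<forall>h\<in>K. h x \<le> h w) \<and> (\<forall>k\<in>H. k w \<le> k x)" if "finite K" "K \<subseteq> H" for K
    using that
  proof (induction K rule: finite_induct)
    case empty
    show ?case using below[OF _ H(1) order_refl] False by blast
  next
    case (insert h K)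
    obtain w where w: "w \<in> F" "\<forall>h\<in>K. h x \<le> h w" "\<forall>k\<in>H. k w \<le> k x" using insert by auto
    obtain v where v: "v \<in> F" "h v = h x" "\<forall>k\<in>H. k v \<le> k x"
      using below[OF _ H(1) order_refl, of h] insert by auto
    have "sup v w \<in> F" using F v w by (simp add: sublattice_def)
    moreover have g: "g (sup v w) = max (g v) (g w)" if "g \<in> H" for g
      using H(2)[OF that] by (rule lattice_hom_sup)
    have "g x \<le> g (sup v w)" if "g \<in> insert h K" for g
      using g[of g] that insert.prems v w by (auto simp: le_max_iff_disj)
    moreover have "g (sup v w) \<le> g x" if "g \<in> H" for g
      using g[OF that] that v w by simp
    ultimately show ?case by blast
  qed
  from this[OF H(1) order_refl] show ?thesis by (meson order_antisym)
qed

text \<open>The image of \<open>F\<close> under \<open>(h, k)\<close> is a proper sublattice of the plane. A line in the plane is a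
sublattice only if it is spanned by a vector with nonnegative coordinates, whence the signs of
\<open>p\<close> and \<open>q\<close>. If \<open>h\<close> vanishes on \<open>F\<close>, then \<open>h\<close> or \<open>k\<close> alone separates \<open>x\<close> from
\<open>F\<close>; this is the case \<open>p = 1\<close>, \<open>q = 0\<close>.\<close>

lemma two_lattice_homs_separation:
  assumes F: "sublattice F" and h: "lattice_hom h" and k: "lattice_hom k"
    and sep: "\<not> (\<exists>w\<in>F. h w = h x \<and> k w = k x)"
  obtains p q g g' where "0 \<le> p" "0 \<le> q" "g \<in> {h, k}" "g' \<in> {h, k}"
    "\<forall>y\<in>F. p * g' y - q * g y = (0::real)" "p * g' x - q * g x \<noteq> 0"
proof -
  have sub: "subspace F" using F by (simp add: sublattice_def)
  note lin = lattice_hom_linear[OF h] lattice_hom_linear[OF k]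
  note simps = lin[THEN linear_add] lin[THEN linear_diff] lin[THEN linear_scale]
  show thesis
  proof (cases "\<exists>w\<in>F. h w \<noteq> 0")
    case True
    then obtain w0 where "w0 \<in> F" "h w0 \<noteq> 0" by blast
    then obtain w where w: "w \<in> F" "0 < h w" "0 \<le> k w"
      using F h k lattice_hom_nonneg[OF k]
      by (metis abs_ge_zero lattice_hom_abs sublattice_iff_abs zero_less_abs_iff)
    have fit: "h w * k (v - (h v / h w) *\<^sub>R w) = h w * k v - k w * h v"
      "h (v - (h v / h w) *\<^sub>R w) = 0" for v
      using w(2) by (auto simp: simps field_simps)
    have vanish: "h w * k y - k w * h y = 0" if y: "y \<in> F" for y
    proof (rule ccontr)
      define v where "v = y - (h y / h w) *\<^sub>R w"
      assume "h w * k y - k w * h y \<noteq> 0"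
      hence v: "v \<in> F" "h v = 0" "k v \<noteq> 0"
        using fit[of y] y w(1) subspace_diff[OF sub] subspace_scale[OF sub] by (auto simp: v_def)
      \<comment> \<open>\<open>w\<close> and \<open>v\<close> have independent images, so some combination has the values of \<open>x\<close>.\<close>
      define a where "a = h x / h w"
      define u where "u = a *\<^sub>R w + ((k x - a * k w) / k v) *\<^sub>R v"
      have "u \<in> F" unfolding u_def using v(1) w(1) subspace_add[OF sub] subspace_scale[OF sub] by blast
      moreover have "h u = h x" "k u = k x" using v w(2) by (simp_all add: u_def a_def simps)
      ultimately show False using sep by blast
    qed
    have "h w * k x - k w * h x \<noteq> 0"
    proof
      assume eq: "h w * k x - k w * h x = 0"
      have "h ((h x / h w) *\<^sub>R w) = h x" "k ((h x / h w) *\<^sub>R w) = k x"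
        using eq w(2) by (simp_all add: simps field_simps)
      with sep w(1) subspace_scale[OF sub] show False by blast
    qed
    moreover have "\<forall>y\<in>F. h w * k y - k w * h y = 0" using vanish by (rule ballI)
    moreover have "0 \<le> h w" using w(2) by simp
    ultimately show thesis using w(3) by (intro that[of "h w" "k w" h k]) simp_all
  next
    case hF: False
    show thesis
    proof (cases "h x = 0")
      case False
      thus thesis using hF by (intro that[of 1 0 h h]) simp_all
    next
      case True
      have kF: "k y = 0" if "y \<in> F" for y
      proof (rule ccontr)
        assume "k y \<noteq> 0"
        hence "k ((k x / k y) *\<^sub>R y) = k x" by (simp add: simps)
        moreover have "(k x / k y) *\<^sub>R y \<in> F" using that by (rule subspace_scale[OF sub])
        ultimately show False using sep hF True by metis
      qed
      have "k x \<noteq> 0"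
        using sep subspace_0[OF sub] True linear_0[OF lin(1)] linear_0[OF lin(2)] by metis
      thus thesis using kF by (intro that[of 1 0 k k]) simp_all
    qed
  qed
qed

lemma codimension_one_separation:
  assumes F: "sublattice F" "uniformly_closed F" "has_codimension F n" and x: "x \<notin> F"
  obtains \<phi> where "linear \<phi>" "sublattice {y. \<phi> y = (0::real)}" "uniformly_closed {y. \<phi> y = 0}"
    "\<forall>y\<in>F. \<phi> y = 0" "\<phi> x \<noteq> 0"
proof -
  have sub: "subspace F" using F by (simp add: sublattice_def)
  obtain H where H: "finite H" "\<And>h. h \<in> H \<Longrightarrow> lattice_hom h"
      "\<And>y. (\<And>h. h \<in> H \<Longrightarrow> h y = 0) \<Longrightarrow> y \<in> F"
    using finite_codimension_lattice_homs[OF F] by blast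
  have "\<not> (\<exists>w\<in>F. \<forall>h\<in>H. h w = h x)"
  proof
    assume "\<exists>w\<in>F. \<forall>h\<in>H. h w = h x"
    then obtain w where w: "w \<in> F" "\<And>h. h \<in> H \<Longrightarrow> h w = h x" by blast
    have "x - w \<in> F"
    proof (rule H(3))
      fix h assume h: "h \<in> H"
      show "h (x - w) = 0" using w(2)[OF h] linear_diff[OF lattice_hom_linear[OF H(2)[OF h]]] by simp
    qed
    from subspace_add[OF sub this w(1)] x show False by simp
  qed
  with two_point_interpolation[OF F(1) H(1,2), of x] obtain h k where hk: "h \<in> H" "k \<in> H"
      "\<not> (\<exists>w\<in>F. h w = h x \<and> k w = k x)" by blast
  obtain p q g g' where pq: "0 \<le> p" "0 \<le> q" "g \<in> {h, k}" "g' \<in> {h, k}"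
      "\<forall>y\<in>F. p * g' y - q * g y = 0" "p * g' x - q * g x \<noteq> 0"
    by (rule two_lattice_homs_separation[OF F(1) H(2)[OF hk(1)] H(2)[OF hk(2)] hk(3)])
  have g: "lattice_hom g" "lattice_hom g'" using pq(3,4) hk H(2) by auto
  have "linear (\<lambda>y. p * g' y - q * g y)"
    using g by (intro linearI) (simp_all add: lattice_hom_linear linear_add linear_scale algebra_simps)
  with lattice_hom_diff_kernel[OF g pq(1,2)] pq(5,6) show thesis
    by (intro that[of "\<lambda>y. p * g' y - q * g y"]) simp_all
qed

section \<open>Choosing as many functionals as the codimension\<close>

text \<open>Functionals \<open>g 0, \<dots>, g (m - 1)\<close> from \<open>\<Phi>\<close> and vectors \<open>z 0, \<dots>, z (m - 1)\<close> for which
the matrix of all \<open>g i (z j)\<close> is triangular with nonzero diagonal. If the functionals vanish on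
\<open>F\<close>, the vectors are then linearly independent modulo \<open>F\<close>.\<close>

definition triangular_system ::
  "('a \<Rightarrow> real) set \<Rightarrow> nat \<Rightarrow> (nat \<Rightarrow> 'a \<Rightarrow> real) \<Rightarrow> (nat \<Rightarrow> 'a) \<Rightarrow> bool" where
  "triangular_system \<Phi> m g z \<longleftrightarrow>
     (\<forall>i<m. g i \<in> \<Phi> \<and> g i (z i) \<noteq> 0) \<and> (\<forall>i<m. \<forall>j<m. i < j \<longrightarrow> g i (z j) = 0)"

lemma triangular_system_bound:
  assumes F: "has_codimension F n"
    and \<Phi>: "\<And>\<phi>. \<phi> \<in> \<Phi> \<Longrightarrow> linear \<phi>" "\<And>\<phi> y. \<phi> \<in> \<Phi> \<Longrightarrow> y \<in> F \<Longrightarrow> \<phi> y = 0"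
    and g: "triangular_system \<Phi> m g z"
  shows "m \<le> n"
proof (rule ccontr)
  assume "\<not> m \<le> n"
  then obtain c where c: "\<exists>i<m. c i \<noteq> 0" "(\<Sum>i<m. c i *\<^sub>R z i) \<in> F"
    using codimension_combination[OF F, of "{..<m}" z] by auto
  have "c i = 0" if "i < m" for i
    using that
  proof (induction i rule: less_induct)
    case (less i)
    have gi: "g i \<in> \<Phi>" "g i (z i) \<noteq> 0" using g less.prems by (auto simp: triangular_system_def)
    have "0 = g i (\<Sum>j<m. c j *\<^sub>R z j)" using \<Phi>(2)[OF gi(1) c(2)] by simp
    also have "\<dots> = (\<Sum>j<m. c j * g i (z j))"
      using \<Phi>(1)[OF gi(1)] by (simp add: linear_sum linear_scale)
    also have "\<dots> = (\<Sum>j\<in>{i}. c j * g i (z j))"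
    proof (rule sum.mono_neutral_right)
      show "\<forall>j\<in>{..<m} - {i}. c j * g i (z j) = 0"
      proof
        fix j assume j: "j \<in> {..<m} - {i}"
        show "c j * g i (z j) = 0"
        proof (cases "j < i")
          case True
          thus ?thesis using less.IH[of j] j by simp
        next
          case False
          with j have "i < j" "j < m" by auto
          with g less.prems show ?thesis by (simp add: triangular_system_def)
        qed
      qed
    qed (use less.prems in auto)
    finally show ?case using gi(2) by simp
  qed
  with c(1) show False by blast
qed

text \<open>A triangular system of maximal length \<open>m\<close> cannot be extended by a point outside \<open>F\<close> at which
its functionals vanish, so these functionals determine \<open>F\<close>; as \<open>F\<close> then has codimension at
most \<open>m\<close>, the length is exactly \<open>n\<close>.\<close>

lemma finitely_many_functionals_suffice:
  assumes F: "has_codimension F n"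
    and \<Phi>: "\<And>\<phi>. \<phi> \<in> \<Phi> \<Longrightarrow> linear \<phi>" "\<And>\<phi> y. \<phi> \<in> \<Phi> \<Longrightarrow> y \<in> F \<Longrightarrow> \<phi> y = 0"
    and sep: "\<And>x. x \<notin> F \<Longrightarrow> \<exists>\<phi>\<in>\<Phi>. \<phi> x \<noteq> 0"
  shows "\<exists>g z. (\<forall>i<n. g i \<in> \<Phi> \<and> g i (z i) \<noteq> 0) \<and> F = (\<Inter>i<n. {y. g i y = (0::real)})"
proof -
  define Q where "Q m \<longleftrightarrow> (\<exists>g z. triangular_system \<Phi> m g z)" for m
  have "Q 0" by (simp add: Q_def triangular_system_def)
  have bound: "m \<le> n" if "Q m" for m
  proof -
    obtain g z where "triangular_system \<Phi> m g z" using \<open>Q m\<close> by (auto simp: Q_def)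
    show ?thesis
      by (rule triangular_system_bound[where \<Phi> = \<Phi>, OF F _ _ \<open>triangular_system \<Phi> m g z\<close>])
        (fact \<Phi>)+
  qed
  define m where "m = Greatest Q"
  have "Q m" unfolding m_def using \<open>Q 0\<close> bound by (rule GreatestI_nat)
  then obtain g z where gz: "triangular_system \<Phi> m g z" by (auto simp: Q_def)
  have "k \<le> m" if "Q k" for k
    unfolding m_def using that bound by (rule Greatest_le_nat)
  hence "\<not> Q (Suc m)" by (meson Suc_n_not_le_n)
  have gm: "g i \<in> \<Phi>" "g i (z i) \<noteq> 0" if "i < m" for i
    using gz that by (auto simp: triangular_system_def)
  have eq: "x \<in> F \<longleftrightarrow> (\<forall>i<m. g i x = 0)" for x
  proof
    assume "x \<in> F"
    thus "\<forall>i<m. g i x = 0" using \<Phi>(2)[OF gm(1)] by simp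
  next
    assume x: "\<forall>i<m. g i x = 0"
    show "x \<in> F"
    proof (rule ccontr)
      assume "x \<notin> F"
      then obtain \<phi> where "\<phi> \<in> \<Phi>" "\<phi> x \<noteq> 0" using sep by blast
      hence "triangular_system \<Phi> (Suc m) (g(m := \<phi>)) (z(m := x))"
        using gz x by (simp add: triangular_system_def less_Suc_eq)
      hence "Q (Suc m)" unfolding Q_def by (intro exI)
      with \<open>\<not> Q (Suc m)\<close> show False by contradiction
    qed
  qed
  have "m = n"
  proof (rule ccontr)
    assume "m \<noteq> n"
    hence "m < n" using bound[OF \<open>Q m\<close>] by simp
    have sub: "subspace F" using F by (simp add: has_codimension_def)
    obtain b where b: "\<And>c. (\<Sum>i<n. c i *\<^sub>R b i) \<in> F \<Longrightarrow> \<forall>i<n. c i = 0"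
    proof -
      obtain b where "\<forall>c. (\<Sum>i<n. c i *\<^sub>R b i) \<in> F \<longrightarrow> (\<forall>i<n. c i = 0)"
        using F sub by (auto simp: has_codimension_def coset_eq_iff)
      with that show thesis by blast
    qed
    obtain c where c: "\<exists>i\<in>{..<n}. c i \<noteq> 0" "\<forall>j\<in>{..<m}. (\<Sum>i<n. c i * g j (b i)) = 0"
      using homogeneous_system_nontrivial[of "{..<m}" "{..<n}" "\<lambda>i j. g j (b i)"] \<open>m < n\<close> by auto
    have "(\<Sum>i<n. c i *\<^sub>R b i) \<in> F"
      unfolding eq
    proof (intro allI impI)
      fix j assume "j < m"
      thus "g j (\<Sum>i<n. c i *\<^sub>R b i) = 0"
        using \<Phi>(1)[OF gm(1)] c(2) by (simp add: linear_sum linear_scale)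
    qed
    from b[OF this] c(1) show False by auto
  qed
  moreover have "F = (\<Inter>i<m. {y. g i y = 0})" using eq by auto
  ultimately show ?thesis using gm by (intro exI[of _ g] exI[of _ z]) simp
qed

theorem theorem5p16:
  fixes F :: "'a::archimedean_vector_lattice set" and n :: nat
  assumes "sublattice F" and "uniformly_closed F" and "has_codimension F n"
  shows "\<exists>G :: nat \<Rightarrow> 'a set.
           (\<forall>i<n. sublattice (G i) \<and> uniformly_closed (G i) \<and> has_codimension (G i) 1) \<and>
           F = (\<Inter>i<n. G i)"
proof -
  define \<Phi> where "\<Phi> = {\<phi>. linear \<phi> \<and> sublattice {y. \<phi> y = (0::real)} \<and>
    uniformly_closed {y. \<phi> y = 0} \<and> (\<forall>y\<in>F. \<phi> y = 0)}"
  have "\<exists>g z. (\<forall>i<n. g i \<in> \<Phi> \<and> g i (z i) \<noteq> 0) \<and> F = (\<Inter>i<n. {y. g i y = (0::real)})"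
  proof (rule finitely_many_functionals_suffice[OF assms(3)])
    fix x assume "x \<notin> F"
    then obtain \<phi> where "linear \<phi>" "sublattice {y. \<phi> y = (0::real)}" "uniformly_closed {y. \<phi> y = 0}"
        "\<forall>y\<in>F. \<phi> y = 0" "\<phi> x \<noteq> 0"
      by (rule codimension_one_separation[OF assms])
    hence "\<phi> \<in> \<Phi>" "\<phi> x \<noteq> 0" by (simp_all add: \<Phi>_def)
    thus "\<exists>\<phi>\<in>\<Phi>. \<phi> x \<noteq> 0" by blast
  qed (simp_all add: \<Phi>_def)
  then obtain g z where g: "\<And>i. i < n \<Longrightarrow> g i \<in> \<Phi>" "\<And>i. i < n \<Longrightarrow> g i (z i) \<noteq> 0"
      and F: "F = (\<Inter>i<n. {y. g i y = 0})" by blast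
  have "sublattice {y. g i y = 0} \<and> uniformly_closed {y. g i y = 0} \<and>
      has_codimension {y. g i y = 0} 1" if "i < n" for i
  proof -
    have "g i \<in> \<Phi>" "g i (z i) \<noteq> 0" using g[OF that] .
    thus ?thesis using has_codimension_kernel[of "g i" "z i"] by (simp add: \<Phi>_def)
  qed
  with F show ?thesis by (intro exI[of _ "\<lambda>i. {y. g i y = 0}"] conjI allI impI) simp_all
qed

end
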